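(* Let $n\ge2$ and let $E$ be the extension operator associated with the paraboloid $\{(\xi,\phi(\xi)):\xi\in\mathbb{R}^{n-1}\}$, $\phi(\xi)=|\xi|^2$. Then for all $g_1,\dots,g_n\in L^1(\mathbb{R}^{n-1})$, the $n$-fold convolution $|Eg_1|^2*\cdots*|Eg_n|^2$ is a constant function on $\mathbb{R}^n$ (with values in $[0,\infty]$), and at every point $$|Eg_1|^2*\cdots*|Eg_n|^2= 2^{-(n-1)}(2\pi)^{n(n-1)}\int_{(\mathbb{R}^{n-1})^n}\frac{|g_1(\xi_1)|^2\cdots|g_n(\xi_n)|^2}{\left|\det\begin{pmatrix}1&\cdots&1\\ \xi_1&\cdots&\xi_n\end{pmatrix}\right|}\,d\xi_1\cdots d\xi_n .$$
   Context: Here $Eg(x)=\int_{\mathbb{R}^{n-1}}e^{i(x'\cdot\xi+x_n|\xi|^2)}g(\xi)\,d\xi$ for $x=(x',x_n)\in\mathbb{R}^{n-1}\times\mathbb{R}$ and complex-valued $g\in L^1(\mathbb{R}^{n-1})$. The matrix is the $n\times n$ matrix whose $j$-th column is $(1,\xi_j)^T$, $\xi_j\in\mathbb{R}^{n-1}$ (its determinant vanishes only on a Lebesgue-null set of $(\xi_1,\dots,\xi_n)$). The convolution of nonnegative functions is $(F_1*\cdots*F_n)(y)=\int_{(\mathbb{R}^n)^{n-1}}F_1(x_1)\cdots F_{n-1}(x_{n-1})F_n(y-x_1-\cdots-x_{n-1})\,dx_1\cdots dx_{n-1}$. No support condition on the $g_j$ is imposed; both sides may be $+\infty$ and the identity is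 understood in $[0,\infty]$. *)

theory Defs
  imports "HOL-Analysis.Analysis"
begin

text \<open>
  Conventions, with \<open>n - 1 = CARD('m)\<close> and hence \<open>n = CARD('m option)\<close>: the space
  \<open>\<real>\<^bsup>n-1\<^esup>\<close> is \<^typ>\<open>real ^ 'm\<close>; a point \<open>x = (x', x\<^sub>n)\<close> of
  \<open>\<real>\<^sup>n\<close> is a pair of type \<^typ>\<open>(real ^ 'm) \<times> real\<close>; an \<open>n\<close>-tuple is a family over
  \<^typ>\<open>'m option\<close>, whose first \<open>n - 1\<close> members sit at the indices \<open>Some i\<close> and whose
  \<open>n\<close>-th member sits at \<open>None\<close>.
\<close>

definition paraboloid_extension ::
    "(real ^ 'm \<Rightarrow> complex) \<Rightarrow> (real ^ 'm) \<times> real \<Rightarrow> complex" where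
  "paraboloid_extension g x =
     (LINT \<xi>|lebesgue. exp (\<i> * of_real (fst x \<bullet> \<xi> + snd x * (norm \<xi>)\<^sup>2)) * g \<xi>)"

definition nfold_convolution ::
    "('m::finite option \<Rightarrow> 'a::euclidean_space \<Rightarrow> ennreal) \<Rightarrow> 'a \<Rightarrow> ennreal" where
  "nfold_convolution F y =
     (\<integral>\<^sup>+ x. (\<Prod>i\<in>UNIV. F (Some i) (x i)) * F None (y - (\<Sum>i\<in>UNIV. x i))
        \<partial>(\<Pi>\<^sub>M i\<in>UNIV. lebesgue))"

text \<open>
  The column of index \<open>j\<close> is \<open>(1, \<xi>\<^sub>j)\<^sup>T\<close>; the row of ones has index \<open>None\<close>. Rows and columns
  share an unordered index type, which fixes the determinant only up to sign; it is used
  only through its absolute value.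
\<close>

definition affine_matrix ::
    "('m::finite option \<Rightarrow> real ^ 'm) \<Rightarrow> real ^ 'm option ^ 'm option" where
  "affine_matrix \<xi> = (\<chi> r j. case r of None \<Rightarrow> 1 | Some i \<Rightarrow> \<xi> j $ i)"

end

theory Submission
  imports Defs "HOL-Probability.Characteristic_Functions"
begin

text \<open>
  Written out, \<open>\<Prod>\<^sub>i Eg\<^sub>i(x\<^sub>i) \<cdot> Eg\<^sub>n(y - \<Sum>\<^sub>i x\<^sub>i)\<close> is an oscillatory integral over
  \<open>(\<xi>\<^sub>1, \<dots>, \<xi>\<^sub>n)\<close> with phase \<open>\<Sum>\<^sub>i x\<^sub>i \<cdot> (\<xi>\<^sub>i - \<xi>\<^sub>n, |\<xi>\<^sub>i|\<^sup>2 - |\<xi>\<^sub>n|\<^sup>2)\<close>, and \<open>y\<close> enters only through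
  a unimodular factor of the amplitude. In the coordinates \<open>u\<^sub>i = \<xi>\<^sub>i - \<xi>\<^sub>n\<close>, \<open>\<eta> = \<xi>\<^sub>n\<close> the frequency is
  \<open>(u\<^sub>i, |u\<^sub>i|\<^sup>2 + 2 u\<^sub>i \<cdot> \<eta>)\<close>, which for fixed \<open>u\<close> is affine in \<open>\<eta>\<close> with Jacobian \<open>2\<^bsup>n-1\<^esup> |det u|\<close>.
  So the product is, as a function of \<open>(x\<^sub>1, \<dots>, x\<^bsub>n-1\<^esub>)\<close>, the Fourier transform of an \<open>L\<^sup>1\<close> function,
  and the identity is Plancherel's theorem, which holds in \<open>[0, \<infinity>]\<close> for every \<open>L\<^sup>1\<close> function.
\<close>

section \<open>Lebesgue integrals on Euclidean spaces\<close>

text \<open>For almost every \<open>u\<close> the frequency map in \<eta> is an affine bijection of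
  all of R^(n-1). The change of variables is therefore one to one and onto up to null sets: no sum
  over preimages appears, and no support condition on the amplitudes is needed. The product need not
  be square integrable, so Plancherel is wanted with both sides possibly infinite. Gaussian damping
  makes every intermediate integral converge, and Fatou's lemma removes the damping in both
  inequalities. The constants come from two places. The transform is unnormalised on a space of
  dimension (n-1)n, which gives (2 pi)^(n(n-1)). Passing to the new coordinates divides the
  amplitude by the Jacobian J; its square times J leaves one factor 1/J, with J = 2^(n-1) |det u|,
  and column subtraction identifies |det u| with the determinant in the statement. The data are only
  Lebesgue measurable, a property not stable under composition. The computation is therefore done
  for Borel representatives, and only its ends are phrased with completed measures.\<close>

lemma borel_measurable_cis [measurable]: "cis \<in> borel_measurable borel"
  by (intro borel_measurable_continuous_onI continuous_intros)

lemma borel_measurable_cnj [measurable]: "cnj \<in> borel_measurable borel"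
  by (intro borel_measurable_continuous_onI continuous_intros)

text \<open>Without integrability the left-hand side is 0 by the convention for the Bochner
  integral, so the bound needs no hypothesis.\<close>

lemma norm_integral_le_integral_norm:
  fixes f :: "'a \<Rightarrow> 'b::{banach, second_countable_topology}"
  shows "norm (integral\<^sup>L M f) \<le> (\<integral>x. norm (f x) \<partial>M)"
  by (cases "integrable M f") (auto simp: not_integrable_integral_eq)

lemma nn_integral_lborel_add:
  fixes f :: "'a::euclidean_space \<Rightarrow> ennreal"
  assumes [measurable]: "f \<in> borel_measurable borel"
  shows "(\<integral>\<^sup>+x. f (c + x) \<partial>lborel) = (\<integral>\<^sup>+x. f x \<partial>lborel)"
proof -
  have "(\<integral>\<^sup>+x. f x \<partial>lborel) = (\<integral>\<^sup>+x. f x \<partial>distr lborel borel ((+) c))"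
    by (simp add: lborel_distr_plus)
  then show ?thesis by (simp add: nn_integral_distr)
qed

lemma integrable_lborel_add:
  fixes f :: "'a::euclidean_space \<Rightarrow> 'b::{banach, second_countable_topology}"
  assumes "integrable lborel f"
  shows "integrable lborel (\<lambda>x. f (c + x))"
proof -
  have "integrable (distr lborel borel ((+) c)) f"
    using assms by (simp add: lborel_distr_plus)
  then show ?thesis by (subst (asm) integrable_distr_eq) (use assms in auto)
qed

lemma integral_lborel_add:
  fixes f :: "'a::euclidean_space \<Rightarrow> 'b::{banach, second_countable_topology}"
  assumes [measurable]: "f \<in> borel_measurable borel"
  shows "(\<integral>x. f (c + x) \<partial>lborel) = (\<integral>x. f x \<partial>lborel)"
proof -
  have "(\<integral>x. f x \<partial>lborel) = (\<integral>x. f x \<partial>distr lborel borel ((+) c))"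
    by (simp add: lborel_distr_plus)
  then show ?thesis by (simp add: integral_distr)
qed

lemma integral_lborel_scaleR:
  fixes f :: "'a::euclidean_space \<Rightarrow> 'b::{banach, second_countable_topology}"
  assumes [measurable]: "f \<in> borel_measurable borel" and c: "c > 0"
  shows "(\<integral>x. f x \<partial>lborel) = c ^ DIM('a) *\<^sub>R (\<integral>x. f (c *\<^sub>R x) \<partial>lborel)"
proof -
  have "(\<integral>x. f x \<partial>lborel) =
      (\<integral>x. f x \<partial>density (distr lborel borel (\<lambda>x. 0 + c *\<^sub>R x)) (\<lambda>_. \<bar>c\<bar>^DIM('a)))"
    using lborel_affine[of c "0::'a"] c by simp
  also have "\<dots> = c ^ DIM('a) *\<^sub>R (\<integral>x. f (c *\<^sub>R x) \<partial>lborel)"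
    using c by (subst integral_density) (auto simp: integral_distr)
  finally show ?thesis .
qed

lemma integrable_lborel_scaleR:
  fixes f :: "'a::euclidean_space \<Rightarrow> 'b::{banach, second_countable_topology}"
  assumes f: "integrable lborel f" and c: "c > 0"
  shows "integrable lborel (\<lambda>x. f (c *\<^sub>R x))"
proof -
  have [measurable]: "f \<in> borel_measurable borel" using f by auto
  have "integrable (density (distr lborel borel (\<lambda>x. 0 + c *\<^sub>R x)) (\<lambda>_. \<bar>c\<bar>^DIM('a))) f"
    using lborel_affine[of c "0::'a"] c f by simp
  then have "integrable (distr lborel borel (\<lambda>x. c *\<^sub>R x)) (\<lambda>x. c ^ DIM('a) *\<^sub>R f x)"
    using c by (subst (asm) integrable_density) auto
  then have "integrable lborel (\<lambda>x. c ^ DIM('a) *\<^sub>R f (c *\<^sub>R x))"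
    by (subst (asm) integrable_distr_eq) auto
  from integrable_scaleR_right[OF this, of "inverse (c ^ DIM('a))"] show ?thesis
    using c by simp
qed

text \<open>Lebesgue measure is the image of a product of one-dimensional Lebesgue measures, so
  functions that split over the coordinates integrate factor by factor. This reduces the Gaussian to
  one dimension.\<close>

lemma lborel_integrable_prod_Basis:
  fixes f :: "'a::euclidean_space \<Rightarrow> real \<Rightarrow> complex"
  assumes "\<And>b. b \<in> Basis \<Longrightarrow> integrable lborel (f b)"
  shows "integrable lborel (\<lambda>x::'a. \<Prod>b\<in>Basis. f b (x \<bullet> b))" (is ?I)
    and "(\<integral>x. (\<Prod>b\<in>Basis. f b (x \<bullet> b)) \<partial>lborel) = (\<Prod>b\<in>Basis. \<integral>t. f b t \<partial>lborel)" (is ?E)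
proof -
  interpret product_sigma_finite "\<lambda>_::'a. lborel :: real measure" ..
  let ?T = "\<lambda>y. (\<Sum>b\<in>Basis. y b *\<^sub>R b) :: 'a"
  have [measurable]: "f b \<in> borel_measurable borel" if "b \<in> Basis" for b
    using assms[OF that] by auto
  have eq: "(\<Prod>b\<in>Basis. f b (?T y \<bullet> b)) = (\<Prod>b\<in>Basis. f b (y b))" for y
    by (intro prod.cong) (auto simp: inner_sum_left inner_Basis if_distrib cong: if_cong)
  have T: "?T \<in> measurable (\<Pi>\<^sub>M b\<in>Basis. lborel) borel" by measurable
  have m: "(\<lambda>x::'a. \<Prod>b\<in>Basis. f b (x \<bullet> b)) \<in> borel_measurable borel"
    by measurable
  show ?I
    unfolding lborel_eq[where 'a='a]
    by (subst integrable_distr_eq[OF T m])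
      (simp only: eq, intro product_integrable_prod assms, auto)
  show ?E
    unfolding lborel_eq[where 'a='a]
    by (subst integral_distr[OF T m])
      (simp only: eq, intro product_integral_prod assms, auto)
qed

section \<open>Plancherel's theorem for integrable functions\<close>

text \<open>The transform is unnormalised, with the sign of the extension operator; hence the factor
  (2 pi)^d in Plancherel's theorem.\<close>

definition fourier :: "('a::euclidean_space \<Rightarrow> complex) \<Rightarrow> 'a \<Rightarrow> complex" where
  "fourier f x = (\<integral>v. cis (x \<bullet> v) * f v \<partial>lborel)"

lemma borel_measurable_fourier [measurable]:
  assumes [measurable]: "f \<in> borel_measurable borel"
  shows "fourier f \<in> borel_measurable borel"
  unfolding fourier_def[abs_def] by measurable

lemma norm_fourier_le: "norm (fourier f x) \<le> (\<integral>v. norm (f v) \<partial>lborel)"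
  unfolding fourier_def
  using norm_integral_le_integral_norm[of lborel "\<lambda>v. cis (x \<bullet> v) * f v"] by (simp add: norm_mult)

lemma integrable_cis_mult:
  assumes "integrable M f" and [measurable]: "h \<in> borel_measurable M"
  shows "integrable M (\<lambda>v. cis (h v) * f v)"
  using assms(1)
  by (rule Bochner_Integration.integrable_bound) (use assms in \<open>auto simp: norm_mult\<close>)

lemma integrable_fst_mult_snd:
  fixes f :: "'a::euclidean_space \<Rightarrow> 'c::{banach, second_countable_topology, real_normed_field}"
    and g :: "'b::euclidean_space \<Rightarrow> 'c"
  assumes f: "integrable lborel f" and g: "integrable lborel g"
  shows "integrable (lborel \<Otimes>\<^sub>M lborel) (\<lambda>(x, y). f x * g y)"
proof -
  have [measurable]: "f \<in> borel_measurable borel" "g \<in> borel_measurable borel"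
    using f g by auto
  show ?thesis
    using f g
    by (intro lborel_pair.Fubini_integrable) (auto simp: norm_mult split: prod.split)
qed

text \<open>Fubini applies because the kernel is unimodular, so the integrand is dominated by the
  tensor product of two integrable functions.\<close>

lemma fourier_multiplication:
  assumes f: "integrable lborel f" and g: "integrable lborel g"
  shows "(\<integral>x. f x * fourier g x \<partial>lborel) = (\<integral>v. fourier f v * g v \<partial>lborel)"
proof -
  have [measurable]: "f \<in> borel_measurable borel" "g \<in> borel_measurable borel"
    using f g by auto
  have "integrable (lborel \<Otimes>\<^sub>M lborel) (\<lambda>p. cis (fst p \<bullet> snd p) * (case p of (x, v) \<Rightarrow> f x * g v))"
    by (intro integrable_cis_mult integrable_fst_mult_snd f g) measurable
  then have int: "integrable (lborel \<Otimes>\<^sub>M lborel) (case_prod (\<lambda>x v. cis (x \<bullet> v) * (f x * g v)))"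
    by (simp add: case_prod_beta')
  have "(\<integral>x. f x * fourier g x \<partial>lborel) = (\<integral>x. \<integral>v. cis (x \<bullet> v) * (f x * g v) \<partial>lborel \<partial>lborel)"
    unfolding fourier_def by (subst integral_mult_right_zero[symmetric]) (simp add: mult_ac)
  also have "\<dots> = (\<integral>v. \<integral>x. cis (x \<bullet> v) * (f x * g v) \<partial>lborel \<partial>lborel)"
    using int by (rule lborel_pair.Fubini_integral[symmetric])
  also have "\<dots> = (\<integral>v. fourier f v * g v \<partial>lborel)"
    unfolding fourier_def by (subst integral_mult_left_zero[symmetric]) (simp add: mult_ac inner_commute)
  finally show ?thesis .
qed

section \<open>Gaussians and their Fourier transforms\<close>

definition gauss :: "'a::euclidean_space \<Rightarrow> real" where
  "gauss x = exp (- (norm x)\<^sup>2 / 2)"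

lemma gauss_nonneg [simp]: "gauss x \<ge> 0" and gauss_le_1: "gauss x \<le> 1"
  by (auto simp: gauss_def)

lemma borel_measurable_gauss [measurable]: "gauss \<in> borel_measurable borel"
  unfolding gauss_def[abs_def] by measurable

lemma gauss_prod: "gauss (x::'a::euclidean_space) = (\<Prod>b\<in>Basis. exp (- (x \<bullet> b)\<^sup>2 / 2))"
proof -
  have "(norm x)\<^sup>2 = (\<Sum>b\<in>Basis. (x \<bullet> b)\<^sup>2)"
    by (metis (no_types, lifting) power2_norm_eq_inner euclidean_inner power2_eq_square sum.cong)
  then show ?thesis
    by (simp add: gauss_def exp_sum[symmetric] sum_negf sum_divide_distrib[symmetric])
qed

text \<open>Up to the factor \<open>sqrt (2 * pi)\<close> the Gaussian is the standard normal
  density, so its transform is the known characteristic function.\<close>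

lemma fourier_gauss_real:
  fixes u :: real
  shows "integrable lborel (\<lambda>t. cis (u * t) * of_real (exp (- t\<^sup>2 / 2)))"
    and "(\<integral>t. cis (u * t) * of_real (exp (- t\<^sup>2 / 2)) \<partial>lborel) = of_real (sqrt (2 * pi) * exp (- u\<^sup>2 / 2))"
proof -
  have e: "exp (- t\<^sup>2 / 2) = sqrt (2 * pi) * std_normal_density t" for t
    by (simp add: std_normal_density_def)
  have 1: "integrable lborel (\<lambda>t. of_real (exp (- t\<^sup>2 / 2)) :: complex)"
    unfolding e using integrable_normal_density[of 1 0] by simp
  show "integrable lborel (\<lambda>t. cis (u * t) * of_real (exp (- t\<^sup>2 / 2)))"
    by (intro integrable_cis_mult 1) auto
  have "(\<integral>t. cis (u * t) * of_real (exp (- t\<^sup>2 / 2)) \<partial>lborel) = 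
    (\<integral>t. of_real (sqrt (2*pi)) * (std_normal_density t *\<^sub>R cis (u * t)) \<partial>lborel)"
    unfolding e by (intro Bochner_Integration.integral_cong) (auto simp: scaleR_conv_of_real mult_ac)
  also have "\<dots> = of_real (sqrt (2 * pi)) * char std_normal_distribution u"
    unfolding char_def
    by (subst integral_density) (auto simp: normal_density_nonneg cis_conv_exp simp del: mult_scaleR_right simp flip: mult_scaleR_right)
  finally show "(\<integral>t. cis (u * t) * of_real (exp (- t\<^sup>2 / 2)) \<partial>lborel) = of_real (sqrt (2 * pi) * exp (- u\<^sup>2 / 2))"
    by (simp add: char_std_normal_distribution)
qed

lemma cis_sum: "cis (sum f A) = (\<Prod>a\<in>A. cis (f a))"
  by (induction A rule: infinite_finite_induct) (auto simp: cis_mult[symmetric])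

lemma fourier_gauss:
  fixes u :: "'a::euclidean_space"
  shows "integrable lborel (gauss :: 'a \<Rightarrow> real)"
    and "fourier (\<lambda>x. of_real (gauss x)) u = of_real (sqrt (2 * pi) ^ DIM('a) * gauss u)"
proof -
  have e: "cis (u \<bullet> x) * of_real (gauss x) =
      (\<Prod>b\<in>Basis. cis ((u \<bullet> b) * (x \<bullet> b)) * of_real (exp (- (x \<bullet> b)\<^sup>2 / 2)))" for u x :: 'a
    by (subst euclidean_inner, unfold cis_sum gauss_prod) (simp add: prod.distrib)
  have "integrable lborel (\<lambda>x::'a. cis (0 \<bullet> x) * of_real (gauss x))"
    unfolding e by (intro lborel_integrable_prod_Basis fourier_gauss_real)
  then show "integrable lborel (gauss :: 'a \<Rightarrow> real)"
    by (simp add: complex_of_real_integrable_eq)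
  show "fourier (\<lambda>x. of_real (gauss x)) u = of_real (sqrt (2 * pi) ^ DIM('a) * gauss u)"
    unfolding fourier_def e
    by (subst lborel_integrable_prod_Basis, rule fourier_gauss_real, subst fourier_gauss_real)
      (simp add: prod.distrib gauss_prod)
qed

lemma integral_gauss: "(\<integral>x. gauss (x::'a::euclidean_space) \<partial>lborel) = sqrt (2 * pi) ^ DIM('a)"
proof -
  have "fourier (\<lambda>x::'a. of_real (gauss x)) 0 = of_real (\<integral>x. gauss (x::'a) \<partial>lborel)"
    by (simp add: fourier_def)
  moreover have "gauss (0::'a) = 1" by (simp add: gauss_def)
  ultimately show ?thesis
    by (simp only: fourier_gauss of_real_eq_iff mult_1_right)
qed


section \<open>Regularised inversion and the upper bound in Plancherel's theorem\<close>

lemma norm_integral_le_nn_integral: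
  fixes f :: "'a \<Rightarrow> 'b::{banach, second_countable_topology}"
  shows "ennreal (norm (integral\<^sup>L M f)) \<le> (\<integral>\<^sup>+x. norm (f x) \<partial>M)"
  by (cases "integrable M f") (auto simp: not_integrable_integral_eq intro: integral_norm_bound_ennreal)

text \<open>The multiplication formula moves the transform from \<open>H\<close> onto a modulated,
  dilated Gaussian. The transform of that is a Gaussian bump of width \<open>s\<close> centred at
  \<open>v\<close>, and rescaling about \<open>v\<close> gives the average on the right.\<close>

lemma fourier_inversion_gauss:
  fixes H :: "'a::euclidean_space \<Rightarrow> complex"
  assumes H: "integrable lborel H" and s: "s > 0"
  shows "fourier (\<lambda>x. fourier H x * of_real (gauss (s *\<^sub>R x))) (- v) =
    of_real (sqrt (2 * pi) ^ DIM('a)) * (\<integral>z. H (v + s *\<^sub>R z) * of_real (gauss z) \<partial>lborel)"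
proof -
  have [measurable]: "H \<in> borel_measurable borel" using H by auto
  define C where "C = complex_of_real (sqrt (2 * pi) ^ DIM('a))"
  define f where "f x = cis (- v \<bullet> x) * of_real (gauss (s *\<^sub>R x))" for x
  have f: "integrable lborel f"
    unfolding f_def using integrable_lborel_scaleR[OF fourier_gauss(1) s]
    by (intro integrable_cis_mult) (auto simp: complex_of_real_integrable_eq)
  have ff: "fourier f z = C * of_real (gauss ((z - v) /\<^sub>R s)) / of_real (s ^ DIM('a))" for z
  proof -
    have "fourier (\<lambda>x. of_real (gauss x)) ((z - v) /\<^sub>R s) = s ^ DIM('a) *\<^sub>R fourier f z"
      unfolding fourier_def
      by (subst integral_lborel_scaleR[OF _ s])
        (use s in \<open>auto simp: f_def inner_diff_left cis_mult mult.assoc[symmetric]\<close>)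
    then show ?thesis
      using s by (simp add: fourier_gauss C_def scaleR_conv_of_real field_simps)
  qed
  have "fourier (\<lambda>x. fourier H x * of_real (gauss (s *\<^sub>R x))) (- v) = (\<integral>x. f x * fourier H x \<partial>lborel)"
    by (simp add: fourier_def[of "\<lambda>x. fourier H x * of_real (gauss (s *\<^sub>R x))"] f_def mult_ac)
  also have "\<dots> = (\<integral>z. fourier f z * H z \<partial>lborel)"
    by (rule fourier_multiplication[OF f H])
  also have "\<dots> = (\<integral>z. C * of_real (gauss (z /\<^sub>R s)) / of_real (s ^ DIM('a)) * H (v + z) \<partial>lborel)"
    unfolding ff by (subst integral_lborel_add[of _ v, symmetric]) auto
  also have "\<dots> = (\<integral>z. C * (H (v + s *\<^sub>R z) * of_real (gauss z)) \<partial>lborel)"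
    by (subst integral_lborel_scaleR[OF _ s], measurable, subst integral_scaleR_right[symmetric])
      (use s in \<open>simp add: scaleR_conv_of_real mult_ac\<close>)
  finally show ?thesis by (simp add: C_def)
qed

lemma nn_integral_gauss: "(\<integral>\<^sup>+x. ennreal (gauss (x::'a::euclidean_space)) \<partial>lborel) = ennreal (sqrt (2 * pi) ^ DIM('a))"
  by (subst nn_integral_eq_integral) (auto simp: fourier_gauss integral_gauss)

text \<open>The damped energy is a pairing of the transform with its own damped conjugate. The
  multiplication formula turns it into a pairing of \<open>H\<close> with a Gaussian average of
  \<open>H\<close>, and the arithmetic-geometric mean inequality splits that into two terms. By
  Tonelli and translation invariance each term equals the Gaussian mass times the energy of
  \<open>H\<close>, also when this energy is infinite.\<close>

lemma fourier_gauss_L2_bound: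
  fixes H :: "'a::euclidean_space \<Rightarrow> complex"
  assumes H: "integrable lborel H" and s: "s > 0"
  shows "(\<integral>\<^sup>+x. ennreal ((norm (fourier H x))\<^sup>2 * gauss (s *\<^sub>R x)) \<partial>lborel) \<le>
    ennreal ((2 * pi) ^ DIM('a)) * (\<integral>\<^sup>+v. ennreal ((norm (H v))\<^sup>2) \<partial>lborel)"
proof -
  have [measurable]: "H \<in> borel_measurable borel" using H by auto
  define C where "C = sqrt (2 * pi) ^ DIM('a)"
  have C: "C > 0" by (simp add: C_def)
  define I where "I = (\<integral>\<^sup>+v. ennreal ((norm (H v))\<^sup>2) \<partial>lborel)"
  define B where "B = (\<integral>v. norm (H v) \<partial>lborel)"
  \<comment> \<open>The conjugate is chosen so that \<open>p x * fourier H x\<close> is the damped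
    square of the norm.\<close>
  define p where "p x = cnj (fourier H x * of_real (gauss (s *\<^sub>R x)))" for x
  have [measurable]: "p \<in> borel_measurable borel"
    unfolding p_def[abs_def] by measurable
  have gs: "integrable lborel (\<lambda>x::'a. gauss (s *\<^sub>R x))"
    by (intro integrable_lborel_scaleR fourier_gauss s)
  have p: "integrable lborel p"
    by (rule Bochner_Integration.integrable_bound[of _ "\<lambda>x. B * gauss (s *\<^sub>R x)"])
      (use gs norm_fourier_le[of H] in \<open>auto simp: p_def norm_mult B_def gauss_nonneg intro!: mult_right_mono
        intro: order_trans[OF _ abs_ge_self]\<close>)
  have i: "integrable lborel (\<lambda>x. (norm (fourier H x))\<^sup>2 * gauss (s *\<^sub>R x))"
    by (rule Bochner_Integration.integrable_bound[of _ "\<lambda>x. B\<^sup>2 * gauss (s *\<^sub>R x)"])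
      (use gs norm_fourier_le[of H] in \<open>auto simp: B_def intro!: mult_right_mono power_mono\<close>)
  have fp: "norm (fourier p v) \<le> C * (\<integral>z. norm (H (v + s *\<^sub>R z)) * gauss z \<partial>lborel)" for v
  proof -
    have "fourier p v = (\<integral>x. cnj (cis (- v \<bullet> x) * (fourier H x * of_real (gauss (s *\<^sub>R x)))) \<partial>lborel)"
      by (simp add: fourier_def[of p] p_def cis_cnj)
    also have "\<dots> = cnj (fourier (\<lambda>x. fourier H x * of_real (gauss (s *\<^sub>R x))) (- v))"
      by (simp only: Bochner_Integration.integral_cnj fourier_def[of "\<lambda>x. fourier H x * of_real (gauss (s *\<^sub>R x))"])
    finally have "fourier p v = \<dots>" .
    then have "norm (fourier p v) = C * norm (\<integral>z. H (v + s *\<^sub>R z) * of_real (gauss z) \<partial>lborel)"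
      using C by (simp add: fourier_inversion_gauss[OF H s] norm_mult norm_power C_def)
    also have "\<dots> \<le> C * (\<integral>z. norm (H (v + s *\<^sub>R z)) * gauss z \<partial>lborel)"
      using norm_integral_le_integral_norm[of lborel "\<lambda>z. H (v + s *\<^sub>R z) * of_real (gauss z)"] C
      by (intro mult_left_mono) (auto simp: norm_mult)
    finally show ?thesis .
  qed
  have amgm: "norm a * norm b \<le> ((norm a)\<^sup>2 + (norm b)\<^sup>2) / 2" for a b :: complex
    using sum_squares_bound[of "norm a" "norm b"] by simp
  have "(\<integral>\<^sup>+x. ennreal ((norm (fourier H x))\<^sup>2 * gauss (s *\<^sub>R x)) \<partial>lborel) =
      ennreal (norm (complex_of_real (\<integral>x. (norm (fourier H x))\<^sup>2 * gauss (s *\<^sub>R x) \<partial>lborel)))"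
    using i by (subst nn_integral_eq_integral) auto
  also have "complex_of_real (\<integral>x. (norm (fourier H x))\<^sup>2 * gauss (s *\<^sub>R x) \<partial>lborel) =
      (\<integral>x. p x * fourier H x \<partial>lborel)"
    unfolding integral_complex_of_real[symmetric]
    by (intro Bochner_Integration.integral_cong)
      (auto simp: p_def complex_norm_square mult_ac simp del: of_real_power)
  also have "\<dots> = (\<integral>v. fourier p v * H v \<partial>lborel)"
    by (rule fourier_multiplication[OF p H])
  also have "ennreal (norm \<dots>) \<le> (\<integral>\<^sup>+v. norm (fourier p v * H v) \<partial>lborel)"
    by (rule norm_integral_le_nn_integral)
  also have "\<dots> \<le> (\<integral>\<^sup>+v. \<integral>\<^sup>+z. ennreal (C / 2) * (ennreal (gauss z) * (ennreal ((norm (H (v + s *\<^sub>R z)))\<^sup>2) + ennreal ((norm (H v))\<^sup>2))) \<partial>lborel \<partial>lborel)"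
  proof (intro nn_integral_mono)
    fix v
    have "ennreal (norm (fourier p v * H v)) \<le> ennreal ((C * (\<integral>z. norm (H (v + s *\<^sub>R z)) * gauss z \<partial>lborel)) * norm (H v))"
      using fp[of v] by (intro ennreal_leI) (auto simp: norm_mult intro!: mult_right_mono)
    also have "\<dots> = ennreal (norm (\<integral>z. C * (norm (H (v + s *\<^sub>R z)) * gauss z) * norm (H v) \<partial>lborel))"
      using C by (simp add: abs_mult integral_nonneg_AE)
    also have "\<dots> \<le> (\<integral>\<^sup>+z. ennreal (C * (norm (H (v + s *\<^sub>R z)) * gauss z) * norm (H v)) \<partial>lborel)"
      by (rule order_trans[OF norm_integral_le_nn_integral]) (use C in \<open>simp add: abs_mult\<close>)
    also have "\<dots> \<le> (\<integral>\<^sup>+z. ennreal (C / 2) * (ennreal (gauss z) * (ennreal ((norm (H (v + s *\<^sub>R z)))\<^sup>2) + ennreal ((norm (H v))\<^sup>2))) \<partial>lborel)"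
    proof (intro nn_integral_mono)
      fix z
      have "C * (norm (H (v + s *\<^sub>R z)) * gauss z) * norm (H v) =
          C * gauss z * (norm (H (v + s *\<^sub>R z)) * norm (H v))" by simp
      also have "\<dots> \<le> C * gauss z * (((norm (H (v + s *\<^sub>R z)))\<^sup>2 + (norm (H v))\<^sup>2) / 2)"
        using C by (intro mult_left_mono amgm) auto
      finally show "ennreal (C * (norm (H (v + s *\<^sub>R z)) * gauss z) * norm (H v)) \<le>
          ennreal (C / 2) * (ennreal (gauss z) * (ennreal ((norm (H (v + s *\<^sub>R z)))\<^sup>2) + ennreal ((norm (H v))\<^sup>2)))"
        using C by (simp flip: ennreal_plus ennreal_mult)
    qed
    finally show "ennreal (norm (fourier p v * H v)) \<le> (\<integral>\<^sup>+z. ennreal (C / 2) * (ennreal (gauss z) * (ennreal ((norm (H (v + s *\<^sub>R z)))\<^sup>2) + ennreal ((norm (H v))\<^sup>2))) \<partial>lborel)" .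
  qed
  also have "\<dots> = ennreal (C / 2) * ((\<integral>\<^sup>+v. \<integral>\<^sup>+z. ennreal (gauss z) * ennreal ((norm (H (v + s *\<^sub>R z)))\<^sup>2) \<partial>lborel \<partial>lborel) +
      (\<integral>\<^sup>+v. \<integral>\<^sup>+z. ennreal (gauss z) * ennreal ((norm (H v))\<^sup>2) \<partial>(lborel :: 'a measure) \<partial>lborel))"
    by (simp add: nn_integral_cmult distrib_left nn_integral_add)
  also have "(\<integral>\<^sup>+v. \<integral>\<^sup>+z. ennreal (gauss z) * ennreal ((norm (H v))\<^sup>2) \<partial>(lborel :: 'a measure) \<partial>lborel) = ennreal C * I"
    by (simp add: nn_integral_multc nn_integral_cmult nn_integral_gauss I_def C_def)
  also have "(\<integral>\<^sup>+v. \<integral>\<^sup>+z. ennreal (gauss z) * ennreal ((norm (H (v + s *\<^sub>R z)))\<^sup>2) \<partial>lborel \<partial>lborel) =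
      (\<integral>\<^sup>+z. \<integral>\<^sup>+v. ennreal (gauss z) * ennreal ((norm (H (v + s *\<^sub>R z)))\<^sup>2) \<partial>lborel \<partial>lborel)"
    by (rule lborel_pair.Fubini') measurable
  also have "\<dots> = (\<integral>\<^sup>+z. ennreal (gauss z) * I \<partial>(lborel :: 'a measure))"
    using nn_integral_lborel_add[of "\<lambda>v. ennreal ((norm (H v))\<^sup>2)"]
    by (intro nn_integral_cong) (simp add: nn_integral_cmult I_def add.commute[of _ "s *\<^sub>R _"])
  also have "\<dots> = ennreal C * I"
    by (simp add: nn_integral_multc nn_integral_gauss C_def)
  \<comment> \<open>The factor 1/2 of the mean inequality cancels the two equal terms, so the
    constant is exactly \<open>C * C\<close>; any loss here would destroy the equality in
    Plancherel's theorem.\<close>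
  also have "ennreal (C / 2) * (ennreal C * I + ennreal C * I) = ennreal (C * C) * I"
    using C by (simp add: distrib_right[symmetric] mult.assoc[symmetric] ennreal_plus[symmetric] ennreal_mult[symmetric] del: ennreal_plus)
  also have "C * C = (2 * pi) ^ DIM('a)"
    unfolding C_def power_mult_distrib[symmetric] by simp
  finally show ?thesis by (simp add: I_def)
qed

lemma tendsto_gauss_scaled: "(\<lambda>n. gauss ((1 / real (Suc n)) *\<^sub>R x)) \<longlonglongrightarrow> 1"
proof -
  have "(\<lambda>n. gauss ((1 / real (Suc n)) *\<^sub>R x)) \<longlonglongrightarrow> exp (- (norm (0 *\<^sub>R x))\<^sup>2 / 2)"
    unfolding gauss_def by (intro tendsto_intros LIMSEQ_Suc[OF lim_1_over_n]) auto
  then show ?thesis by simp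
qed

text \<open>The damped bound is uniform in \<open>s\<close>, so Fatou's lemma lets \<open>s\<close>
  tend to 0.\<close>

lemma fourier_L2_le:
  fixes H :: "'a::euclidean_space \<Rightarrow> complex"
  assumes H: "integrable lborel H"
  shows "(\<integral>\<^sup>+x. ennreal ((norm (fourier H x))\<^sup>2) \<partial>lborel) \<le>
    ennreal ((2 * pi) ^ DIM('a)) * (\<integral>\<^sup>+v. ennreal ((norm (H v))\<^sup>2) \<partial>lborel)"
proof -
  have [measurable]: "H \<in> borel_measurable borel" using H by auto
  let ?f = "\<lambda>n x. ennreal ((norm (fourier H x))\<^sup>2 * gauss ((1 / real (Suc n)) *\<^sub>R x))"
  have "liminf (\<lambda>n. ?f n x) = ennreal ((norm (fourier H x))\<^sup>2)" for x
    using tendsto_mult[OF tendsto_const tendsto_gauss_scaled[of x], of "(norm (fourier H x))\<^sup>2"]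
    by (intro lim_imp_Liminf tendsto_ennrealI) auto
  then have "(\<integral>\<^sup>+x. ennreal ((norm (fourier H x))\<^sup>2) \<partial>lborel) = (\<integral>\<^sup>+x. liminf (\<lambda>n. ?f n x) \<partial>lborel)"
    by simp
  also have "\<dots> \<le> liminf (\<lambda>n. \<integral>\<^sup>+x. ?f n x \<partial>lborel)"
    by (rule nn_integral_liminf) measurable
  also have "\<dots> \<le> liminf (\<lambda>n. ennreal ((2 * pi) ^ DIM('a)) * (\<integral>\<^sup>+v. ennreal ((norm (H v))\<^sup>2) \<partial>lborel))"
    by (intro Liminf_mono always_eventually allI fourier_gauss_L2_bound H) auto
  finally show ?thesis by (simp add: Liminf_const)
qed


section \<open>Continuity of translations in L^1\<close>

lemma tendsto_zero_nonneg_le: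
  fixes f g :: "nat \<Rightarrow> real"
  assumes "g \<longlonglongrightarrow> 0" "\<And>n. 0 \<le> f n" "\<And>n. f n \<le> g n"
  shows "f \<longlonglongrightarrow> 0"
  using tendsto_sandwich[OF always_eventually always_eventually tendsto_const assms(1), of f] assms by blast

text \<open>Continuity is stated along sequences so that dominated convergence can be used
  directly.\<close>

definition L1_translation_continuous :: "('a::euclidean_space \<Rightarrow> complex) \<Rightarrow> bool" where
  "L1_translation_continuous f \<longleftrightarrow>
    (\<forall>h. h \<longlonglongrightarrow> 0 \<longrightarrow> (\<lambda>n. \<integral>x. norm (f (h n + x) - f x) \<partial>lborel) \<longlonglongrightarrow> (0::real))"

text \<open>The property is closed under L^1 limits: translating the approximation error does not
  change its norm, so the error enters twice, whatever the shift.\<close>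

lemma L1_translation_continuous_approx:
  fixes f :: "'a::euclidean_space \<Rightarrow> complex"
  assumes f: "integrable lborel f"
    and approx: "\<And>e. e > 0 \<Longrightarrow> \<exists>g. integrable lborel g \<and> L1_translation_continuous g \<and>
      (\<integral>x. norm (f x - g x) \<partial>lborel) < e"
  shows "L1_translation_continuous f"
  unfolding L1_translation_continuous_def
proof (intro allI impI)
  fix h :: "nat \<Rightarrow> 'a" assume h: "h \<longlonglongrightarrow> 0"
  show "(\<lambda>n. \<integral>x. norm (f (h n + x) - f x) \<partial>lborel) \<longlonglongrightarrow> (0::real)"
  proof (rule LIMSEQ_I)
    fix r :: real assume "r > 0"
    then obtain g where g: "integrable lborel g" "L1_translation_continuous g"
      and fg: "(\<integral>x. norm (f x - g x) \<partial>lborel) < r / 4"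
      using approx[of "r / 4"] by auto
    obtain N where N: "\<And>n. n \<ge> N \<Longrightarrow> (\<integral>x. norm (g (h n + x) - g x) \<partial>lborel) < r / 2"
      using LIMSEQ_D[of "\<lambda>n. \<integral>x. norm (g (h n + x) - g x) \<partial>lborel" 0 "r/2"] g(2) h \<open>r > 0\<close>
      unfolding L1_translation_continuous_def by auto
    have "norm (\<integral>x. norm (f (h n + x) - f x) \<partial>lborel) < r" if "n \<ge> N" for n
    proof -
      note [simp] = integrable_lborel_add[OF f] integrable_lborel_add[OF g(1)] f g(1)
      have d: "integrable lborel (\<lambda>x. norm (f x - g x))" by simp
      have "(\<integral>x. norm (f (h n + x) - f x) \<partial>lborel) \<le>
          (\<integral>x. norm (f (h n + x) - g (h n + x)) + norm (g (h n + x) - g x) + norm (f x - g x) \<partial>lborel)"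
      proof (rule integral_mono)
        fix x
        have "norm (f (h n + x) - f x) = norm ((f (h n + x) - g (h n + x)) + (g (h n + x) - g x) - (f x - g x))" by simp
        then show "norm (f (h n + x) - f x) \<le> norm (f (h n + x) - g (h n + x)) + norm (g (h n + x) - g x) + norm (f x - g x)"
          using norm_triangle_ineq4[of "(f (h n + x) - g (h n + x)) + (g (h n + x) - g x)" "f x - g x"]
            norm_triangle_ineq[of "f (h n + x) - g (h n + x)" "g (h n + x) - g x"] by linarith
      qed auto
      also have "\<dots> = (\<integral>x. norm (f (h n + x) - g (h n + x)) \<partial>lborel) + (\<integral>x. norm (g (h n + x) - g x) \<partial>lborel) + (\<integral>x. norm (f x - g x) \<partial>lborel)"
        by simp
      also have "(\<integral>x. norm (f (h n + x) - g (h n + x)) \<partial>lborel) = (\<integral>x. norm (f x - g x) \<partial>lborel)"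
        using integral_lborel_add[of "\<lambda>x. norm (f x - g x)" "h n"] d by auto
      finally show ?thesis using fg N[OF that] by (simp add: integral_nonneg_AE)
    qed
    then show "\<exists>no. \<forall>n\<ge>no. norm ((\<integral>x. norm (f (h n + x) - f x) \<partial>lborel) - 0) < r" by auto
  qed
qed

text \<open>For an open set \<open>U\<close> of finite measure, \<open>|1\<^sub>U(h + x) - 1\<^sub>U(x)|\<close> has integral
  \<open>2(|U| - |U \<inter> (U - h)|)\<close>, and the intersection converges pointwise on \<open>U\<close>.\<close>

lemma L1_translation_continuous_open:
  assumes U: "open (U :: 'a::euclidean_space set)" and fin: "emeasure lborel U < \<infinity>"
  shows "L1_translation_continuous (\<lambda>x. indicator U x *\<^sub>R c)"
  unfolding L1_translation_continuous_def
proof (intro allI impI)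
  fix h :: "nat \<Rightarrow> 'a" assume h: "h \<longlonglongrightarrow> 0"
  have [measurable]: "U \<in> sets borel" using U by auto
  let ?i = "indicator U :: 'a \<Rightarrow> real"
  have i: "integrable lborel ?i" using fin by simp
  note i' = integrable_lborel_add[OF i]
  have ii: "integrable lborel (\<lambda>x. ?i (y + x) * ?i x)" for y
    by (rule Bochner_Integration.integrable_bound[OF i]) (auto simp: indicator_def)
  have lim: "(\<lambda>n. \<integral>x. ?i (h n + x) * ?i x \<partial>lborel) \<longlonglongrightarrow> (\<integral>x. ?i x \<partial>lborel)"
  proof (rule integral_dominated_convergence[where w="?i"])
    show "AE x in lborel. (\<lambda>n. ?i (h n + x) * ?i x) \<longlonglongrightarrow> ?i x"
    proof (rule AE_I2)
      fix x
      show "(\<lambda>n. ?i (h n + x) * ?i x) \<longlonglongrightarrow> ?i x"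
      proof (cases "x \<in> U")
        case True
        have "(\<lambda>n. h n + x) \<longlonglongrightarrow> x" using tendsto_add[OF h tendsto_const[of x]] by simp
        then have "\<forall>\<^sub>F n in sequentially. h n + x \<in> U"
          using U True by (rule topological_tendstoD)
        then have "\<forall>\<^sub>F n in sequentially. ?i (h n + x) * ?i x = ?i x"
          by eventually_elim (simp add: True)
        then show ?thesis by (rule tendsto_eventually)
      qed simp
    qed
  qed (use i in \<open>auto simp: indicator_def\<close>)
  have eq: "(\<integral>x. norm (?i (h n + x) *\<^sub>R c - ?i x *\<^sub>R c) \<partial>lborel) =
      (2 * (\<integral>x. ?i x \<partial>lborel) - 2 * (\<integral>x. ?i (h n + x) * ?i x \<partial>lborel)) * norm c" for n
  proof -
    have "(\<integral>x. norm (?i (h n + x) *\<^sub>R c - ?i x *\<^sub>R c) \<partial>lborel) =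
      (\<integral>x. (?i (h n + x) + ?i x - 2 * (?i (h n + x) * ?i x)) * norm c \<partial>lborel)"
      by (intro Bochner_Integration.integral_cong) (auto simp: indicator_def)
    also have "\<dots> = ((\<integral>x. ?i (h n + x) \<partial>lborel) + (\<integral>x. ?i x \<partial>lborel) - 2 * (\<integral>x. ?i (h n + x) * ?i x \<partial>lborel)) * norm c"
      using i i' ii by (simp del: integral_indicator)
    finally show ?thesis
      by (simp add: integral_lborel_add del: integral_indicator)
  qed
  show "(\<lambda>n. \<integral>x. norm (?i (h n + x) *\<^sub>R c - ?i x *\<^sub>R c) \<partial>lborel) \<longlonglongrightarrow> 0"
    unfolding eq
    by (rule tendsto_eq_intros lim refl | simp)+
qed

lemma L1_translation_continuous:
  fixes f :: "'a::euclidean_space \<Rightarrow> complex"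
  assumes "integrable lborel f"
  shows "L1_translation_continuous f"
  using assms
proof (induction f rule: integrable_induct)
  case (base A c)
  then have A[measurable]: "A \<in> sets borel" by simp
  show ?case
  proof (rule L1_translation_continuous_approx)
    show "integrable lborel (\<lambda>x. indicator A x *\<^sub>R c)" using base by simp
    fix e :: real assume "e > 0"
    \<comment> \<open>The summand 1 keeps the quotient defined when \<open>c = 0\<close>.\<close>
    define d where "d = e / (norm c + 1)"
    have d: "d > 0" using \<open>e > 0\<close> by (simp add: d_def add_nonneg_pos)
    \<comment> \<open>Outer regularity replaces the Borel set by an open one, for which translation
      continuity is a pointwise limit.\<close>
    obtain U where U: "open U" "A \<subseteq> U" "emeasure lborel (U - A) < ennreal d"
      using outer_regular_lborel[OF A, of d] d by auto
    have [measurable]: "U \<in> sets borel" using U by auto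
    have "emeasure lborel U = emeasure lborel A + emeasure lborel (U - A)"
      using U(2) by (subst plus_emeasure) (auto simp: Un_absorb1)
    also have "\<dots> < \<infinity>" using base U(3)
      by (auto simp: ennreal_add_less_top less_top[symmetric] ennreal_add_eq_top)
    finally have finU: "emeasure lborel U < \<infinity>" .
    have "(\<integral>x. norm (indicator A x *\<^sub>R c - indicator U x *\<^sub>R c) \<partial>lborel) = (\<integral>x. indicator (U - A) x * norm c \<partial>lborel)"
      using U(2) by (intro Bochner_Integration.integral_cong) (auto simp: indicator_def)
    also have "\<dots> = measure lborel (U - A) * norm c"
      by simp
    also have "\<dots> \<le> d * norm c"
      using U(3) d by (intro mult_right_mono) (simp_all add: measure_def enn2real_leI less_imp_le)
    also have "\<dots> < e"
    proof -
      have "d * norm c < d * (norm c + 1)" using d by (intro mult_strict_left_mono) auto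
      also have "\<dots> = e" by (simp add: d_def add_nonneg_eq_0_iff)
      finally show ?thesis .
    qed
    finally show "\<exists>g. integrable lborel g \<and> L1_translation_continuous g \<and>
      (\<integral>x. norm (indicator A x *\<^sub>R c - g x) \<partial>lborel) < e"
      using L1_translation_continuous_open[OF U(1) finU, of c] finU
      by (intro exI[of _ "\<lambda>x. indicator U x *\<^sub>R c"]) auto
  qed
next
  case (add f g)
  show ?case
    unfolding L1_translation_continuous_def
  proof (intro allI impI)
    fix h :: "nat \<Rightarrow> 'a" assume h: "h \<longlonglongrightarrow> 0"
    note [simp] = integrable_lborel_add[OF add(1)] integrable_lborel_add[OF add(2)] add(1,2)
    have "(\<lambda>n. (\<integral>x. norm (f (h n + x) - f x) \<partial>lborel) + (\<integral>x. norm (g (h n + x) - g x) \<partial>lborel)) \<longlonglongrightarrow> 0"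
      using add h by (intro tendsto_add_zero) (auto simp: L1_translation_continuous_def)
    then show "(\<lambda>n. \<integral>x. norm (f (h n + x) + g (h n + x) - (f x + g x)) \<partial>lborel) \<longlonglongrightarrow> 0"
    proof (rule tendsto_zero_nonneg_le)
      show "(\<integral>x. norm (f (h n + x) + g (h n + x) - (f x + g x)) \<partial>lborel) \<le>
        (\<integral>x. norm (f (h n + x) - f x) \<partial>lborel) + (\<integral>x. norm (g (h n + x) - g x) \<partial>lborel)" for n
      proof -
        have "(\<integral>x. norm (f (h n + x) + g (h n + x) - (f x + g x)) \<partial>lborel) \<le>
            (\<integral>x. norm (f (h n + x) - f x) + norm (g (h n + x) - g x) \<partial>lborel)"
          by (intro integral_mono norm_diff_triangle_ineq) auto
        then show ?thesis by simp
      qed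
    qed (simp_all add: integral_nonneg_AE)
  qed
next
  case (lim f s)
  show ?case
  proof (rule L1_translation_continuous_approx[OF lim(4)])
    fix e :: real assume "e > 0"
    have "(\<lambda>i. \<integral>x. norm (f x - s i x) \<partial>lborel) \<longlonglongrightarrow> (\<integral>x. 0 \<partial>(lborel :: 'a measure))"
    \<comment> \<open>The factor 3 is 1 + 2: the approximants satisfy
      \<open>norm (s i x) \<le> 2 * norm (f x)\<close>.\<close>
    proof (rule integral_dominated_convergence[where w="\<lambda>x. 3 * norm (f x)"])
      show "AE x in lborel. (\<lambda>i. norm (f x - s i x)) \<longlonglongrightarrow> 0"
      proof (rule AE_I2)
        fix x :: 'a
        have "(\<lambda>i. norm (f x - s i x)) \<longlonglongrightarrow> norm (f x - f x)"
          using lim(2)[of x] by (intro tendsto_intros) auto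
        then show "(\<lambda>i. norm (f x - s i x)) \<longlonglongrightarrow> 0" by simp
      qed
      show "AE x in lborel. norm (norm (f x - s i x)) \<le> 3 * norm (f x)" for i
      proof (rule AE_I2)
        fix x :: 'a
        show "norm (norm (f x - s i x)) \<le> 3 * norm (f x)"
          using lim(3)[of x i] norm_triangle_ineq4[of "f x" "s i x"] by simp
      qed
    qed (use lim in auto)
    then obtain i where "(\<integral>x. norm (f x - s i x) \<partial>lborel) < e"
      using LIMSEQ_D[of "\<lambda>i. \<integral>x. norm (f x - s i x) \<partial>lborel" 0 e] \<open>e > 0\<close> by force
    then show "\<exists>g. integrable lborel g \<and> L1_translation_continuous g \<and> (\<integral>x. norm (f x - g x) \<partial>lborel) < e"
      using lim by blast
  qed
qed

section \<open>Gaussian averages and equality in Plancherel's theorem\<close>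

lemma gauss_average_tendsto_L1:
  fixes H :: "'a::euclidean_space \<Rightarrow> complex" and s :: "nat \<Rightarrow> real"
  assumes H: "integrable lborel H" and s: "s \<longlonglongrightarrow> 0"
  shows "integrable lborel (\<lambda>v. \<integral>z. (H (v + s n *\<^sub>R z) - H v) * of_real (gauss z) \<partial>lborel)" (is "?A n")
    and "(\<lambda>n. \<integral>v. norm (\<integral>z. (H (v + s n *\<^sub>R z) - H v) * of_real (gauss z) \<partial>lborel) \<partial>lborel) \<longlonglongrightarrow> 0" (is ?B)
proof -
  have [measurable]: "H \<in> borel_measurable borel" using H by auto
  define q where "q n = (\<lambda>z v. (H (v + s n *\<^sub>R z) - H v) * of_real (gauss z))" for n
  \<comment> \<open>\<open>D\<close> is the L^1 modulus of continuity of \<open>H\<close>. By Fubini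
    the L^1 norm of the averaged difference is at most the Gaussian integral of
    \<open>D (s n *\<^sub>R z)\<close>. Since \<open>D\<close> is bounded by twice the norm of
    \<open>H\<close> and vanishes in the limit of small shifts, dominated convergence
    concludes.\<close>
  define D where "D h = (\<integral>v. norm (H (h + v) - H v) \<partial>lborel)" for h
  note [simp] = H integrable_lborel_add[OF H]
  have D_le: "norm (D h) \<le> 2 * (\<integral>v. norm (H v) \<partial>lborel)" for h
  proof -
    have "D h \<le> (\<integral>v. norm (H (h + v)) + norm (H v) \<partial>lborel)"
      unfolding D_def by (intro integral_mono norm_triangle_ineq4) auto
    also have "\<dots> = 2 * (\<integral>v. norm (H v) \<partial>lborel)"
      by (simp add: integral_lborel_add[of "\<lambda>v. norm (H v)"])
    finally show ?thesis by (simp add: D_def integral_nonneg_AE)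
  qed
  have [measurable]: "D \<in> borel_measurable borel"
    unfolding D_def[abs_def] by measurable
  have qn: "(\<integral>v. norm (q n z v) \<partial>lborel) = D (s n *\<^sub>R z) * gauss z" for n z
    by (simp add: q_def norm_mult D_def add.commute)
  have bd: "integrable lborel (\<lambda>z::'a. 2 * (\<integral>v. norm (H v) \<partial>lborel) * gauss z)"
    using fourier_gauss(1)[where 'a='a] by simp
  have q: "integrable (lborel \<Otimes>\<^sub>M lborel) (case_prod (q n))" for n
  proof (rule lborel_pair.Fubini_integrable)
    show "case_prod (q n) \<in> borel_measurable (lborel \<Otimes>\<^sub>M lborel)"
      unfolding q_def by measurable
    show "integrable lborel (\<lambda>x. \<integral>y. norm (case (x, y) of (z, v) \<Rightarrow> q n z v) \<partial>lborel)"
      using bd by (simp add: qn, elim Bochner_Integration.integrable_bound)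
        (use D_le in \<open>auto simp: abs_mult intro!: mult_right_mono intro: order_trans[OF _ abs_ge_self]\<close>)
    show "AE x in lborel. integrable lborel (\<lambda>y. case (x, y) of (z, v) \<Rightarrow> q n z v)"
      by (simp add: q_def add.commute[of _ "s n *\<^sub>R _"])
  qed
  show "?A n" for n
    using lborel_pair.integrable_snd[OF q[of n]] by (simp add: q_def)
  have le: "(\<integral>v. norm (\<integral>z. q n z v \<partial>lborel) \<partial>lborel) \<le> (\<integral>z. D (s n *\<^sub>R z) * gauss z \<partial>lborel)" for n
  proof -
    have qn': "integrable (lborel \<Otimes>\<^sub>M lborel) (case_prod (\<lambda>z v. norm (q n z v)))"
      using integrable_norm[OF q[of n]] by (simp add: case_prod_beta')
    have "(\<integral>v. norm (\<integral>z. q n z v \<partial>lborel) \<partial>lborel) \<le> (\<integral>v. \<integral>z. norm (q n z v) \<partial>lborel \<partial>lborel)"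
      using lborel_pair.integrable_snd[OF q[of n]] lborel_pair.integrable_snd[OF qn']
      by (intro integral_mono norm_integral_le_integral_norm) auto
    also have "\<dots> = (\<integral>z. \<integral>v. norm (q n z v) \<partial>lborel \<partial>lborel)"
      by (rule lborel_pair.Fubini_integral[OF qn'])
    finally show ?thesis by (simp add: qn)
  qed
  have "(\<lambda>n. \<integral>z. D (s n *\<^sub>R z) * gauss z \<partial>(lborel :: 'a measure)) \<longlonglongrightarrow> (\<integral>z. 0 \<partial>(lborel :: 'a measure))"
  proof (rule integral_dominated_convergence[OF _ _ bd])
    show "AE z::'a in lborel. (\<lambda>n. D (s n *\<^sub>R z) * gauss z) \<longlonglongrightarrow> 0"
    proof (rule AE_I2)
      fix z :: 'a
      have "(\<lambda>n. s n *\<^sub>R z) \<longlonglongrightarrow> 0"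
        using tendsto_scaleR[OF s tendsto_const[of z]] by simp
      then have "(\<lambda>n. D (s n *\<^sub>R z)) \<longlonglongrightarrow> 0"
        using L1_translation_continuous[OF H] by (simp add: L1_translation_continuous_def D_def)
      then show "(\<lambda>n. D (s n *\<^sub>R z) * gauss z) \<longlonglongrightarrow> 0"
        using tendsto_mult_left_zero by blast
    qed
    show "AE z::'a in lborel. norm (D (s n *\<^sub>R z) * gauss z) \<le> 2 * (\<integral>v. norm (H v) \<partial>lborel) * gauss z" for n
      using D_le by (auto simp: abs_mult intro!: mult_right_mono)
  qed measurable
  then have "(\<lambda>n. \<integral>z. D (s n *\<^sub>R z) * gauss z \<partial>(lborel :: 'a measure)) \<longlonglongrightarrow> 0" by simp
  then have "(\<lambda>n. \<integral>v. norm (\<integral>z. q n z v \<partial>lborel) \<partial>lborel) \<longlonglongrightarrow> 0"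
    by (rule tendsto_zero_nonneg_le) (simp_all add: integral_nonneg_AE le)
  then show ?B by (simp add: q_def)
qed

text \<open>For the lower bound, the upper bound is applied to the damped transform
  \<open>fourier H x * gauss (s x)\<close>, whose own transform is an average of \<open>H\<close> converging to \<open>H\<close> as
  \<open>s\<close> tends to \<open>0\<close>.\<close>

theorem plancherel:
  fixes H :: "'a::euclidean_space \<Rightarrow> complex"
  assumes H: "integrable lborel H"
  shows "(\<integral>\<^sup>+x. ennreal ((norm (fourier H x))\<^sup>2) \<partial>lborel) =
    ennreal ((2 * pi) ^ DIM('a)) * (\<integral>\<^sup>+v. ennreal ((norm (H v))\<^sup>2) \<partial>lborel)" (is "?L = ?R")
proof (rule antisym[OF fourier_L2_le[OF H]])
  have [measurable]: "H \<in> borel_measurable borel" using H by auto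
  define C where "C = sqrt (2 * pi) ^ DIM('a)"
  have C: "C > 0" by (simp add: C_def)
  have CC: "(2 * pi) ^ DIM('a) = C\<^sup>2"
    unfolding C_def power2_eq_square power_mult_distrib[symmetric] by simp
  define s where "s n = 1 / real (Suc n)" for n
  have s: "s \<longlonglongrightarrow> 0" "\<And>n. s n > 0"
    unfolding s_def using LIMSEQ_Suc[OF lim_1_over_n] by auto
  define J where "J n v = (\<integral>z. H (v + s n *\<^sub>R z) * of_real (gauss z) \<partial>lborel)" for n v
  have [measurable]: "J n \<in> borel_measurable borel" for n
    unfolding J_def[abs_def] by measurable
  have J_diff: "(\<integral>z. (H (v + s n *\<^sub>R z) - H v) * of_real (gauss z) \<partial>lborel) = J n v - of_real C * H v" for n v
  proof -
    have "integrable lborel (\<lambda>z. H (v + s n *\<^sub>R z))"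
      by (rule integrable_lborel_scaleR[OF integrable_lborel_add[OF H] s(2)])
    then have "integrable lborel (\<lambda>z. H (v + s n *\<^sub>R z) * of_real (gauss z))"
      by (rule Bochner_Integration.integrable_bound) (auto simp: norm_mult gauss_le_1 intro!: mult_left_le AE_I2)
    then show ?thesis
      by (simp add: left_diff_distrib fourier_gauss complex_of_real_integrable_eq integral_gauss C_def J_def)
  qed
  \<comment> \<open>L^1 convergence yields convergence almost everywhere only along a subsequence.
    That suffices for Fatou's lemma, since the energy bound below holds for every index.\<close>
  obtain r :: "nat \<Rightarrow> nat" where r: "strict_mono r"
    and ae: "AE v in lborel. (\<lambda>n. J (r n) v - of_real C * H v) \<longlonglongrightarrow> 0"
    using tendsto_L1_AE_subseq[OF gauss_average_tendsto_L1[OF H s(1)]] by (auto simp: J_diff)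
  \<comment> \<open>By regularised inversion the transform of the damped \<open>fourier H\<close>,
    at \<open>- v\<close>, is \<open>C\<close> times \<open>J n v\<close>. The upper bound for that
    function produces the factor \<open>C\<^sup>2\<close> on both sides, where it cancels.\<close>
  have bound: "(\<integral>\<^sup>+v. ennreal ((norm (J n v))\<^sup>2) \<partial>lborel) \<le> ?L" for n
  proof -
    let ?f = "\<lambda>x. fourier H x * of_real (gauss (s n *\<^sub>R x))"
    have f: "integrable lborel ?f"
    proof (rule Bochner_Integration.integrable_bound[of _ "\<lambda>x. (\<integral>v. norm (H v) \<partial>lborel) * gauss (s n *\<^sub>R x)"])
      show "integrable lborel (\<lambda>x. (\<integral>v. norm (H v) \<partial>lborel) * gauss (s n *\<^sub>R x))"
        using integrable_lborel_scaleR[OF fourier_gauss(1) s(2)] by auto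
    qed (use norm_fourier_le[of H] in \<open>auto simp: norm_mult intro!: mult_right_mono intro: order_trans[OF _ abs_ge_self]\<close>)
    have "ennreal (C\<^sup>2) * (\<integral>\<^sup>+v. ennreal ((norm (J n v))\<^sup>2) \<partial>lborel) = (\<integral>\<^sup>+v. ennreal ((norm (fourier ?f (- v)))\<^sup>2) \<partial>lborel)"
      unfolding fourier_inversion_gauss[OF H s(2)]
      by (subst nn_integral_cmult[symmetric], measurable)
        (use C in \<open>auto simp: J_def C_def norm_mult norm_power power_mult_distrib ennreal_mult intro!: nn_integral_cong\<close>)
    also have "\<dots> = (\<integral>\<^sup>+v. ennreal ((norm (fourier ?f v))\<^sup>2) \<partial>lborel)"
    proof -
      have "distr lborel borel uminus = (lborel :: 'a measure)"
        using lborel_affine[of "-1" "0::'a"] by (simp add: density_1)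
      then have "(\<integral>\<^sup>+v. ennreal ((norm (fourier ?f v))\<^sup>2) \<partial>lborel) = (\<integral>\<^sup>+v. ennreal ((norm (fourier ?f v))\<^sup>2) \<partial>distr lborel borel uminus)"
        by simp
      then show ?thesis by (simp add: nn_integral_distr)
    qed
    also have "\<dots> \<le> ennreal (C\<^sup>2) * (\<integral>\<^sup>+v. ennreal ((norm (?f v))\<^sup>2) \<partial>lborel)"
      by (rule fourier_L2_le[OF f, unfolded CC])
    also have "\<dots> \<le> ennreal (C\<^sup>2) * ?L"
      by (intro mult_left_mono nn_integral_mono ennreal_leI power_mono)
        (auto simp: norm_mult gauss_le_1 intro: mult_left_le)
    finally show ?thesis
      using C by (subst (asm) ennreal_mult_le_mult_iff) auto
  qed
  have "?R = (\<integral>\<^sup>+v. ennreal ((norm (of_real C * H v))\<^sup>2) \<partial>lborel)"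
    unfolding CC using C by (subst nn_integral_cmult[symmetric])
      (auto simp: norm_mult power_mult_distrib ennreal_mult)
  also have "\<dots> = (\<integral>\<^sup>+v. liminf (\<lambda>n. ennreal ((norm (J (r n) v))\<^sup>2)) \<partial>lborel)"
  proof (rule nn_integral_cong_AE, use ae in eventually_elim)
    case (elim v)
    then have "(\<lambda>n. J (r n) v) \<longlonglongrightarrow> of_real C * H v" by (simp add: LIM_zero_iff)
    then have "(\<lambda>n. ennreal ((norm (J (r n) v))\<^sup>2)) \<longlonglongrightarrow> ennreal ((norm (of_real C * H v))\<^sup>2)"
      by (intro tendsto_intros)
    then show ?case by (intro lim_imp_Liminf[symmetric]) auto
  qed
  also have "\<dots> \<le> liminf (\<lambda>n. \<integral>\<^sup>+v. ennreal ((norm (J (r n) v))\<^sup>2) \<partial>lborel)"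
    by (rule nn_integral_liminf) measurable
  also have "\<dots> \<le> liminf (\<lambda>n::nat. ?L)"
    by (intro Liminf_mono always_eventually allI bound)
  finally show "?R \<le> ?L" by (simp add: Liminf_const)
qed

section \<open>Linear changes of variables\<close>

text \<open>The bijection \<open>\<beta>\<close> says which coordinate of the target each coordinate
  of each factor becomes. Such a relabelling pulls boxes back to products of boxes of the same
  volume, and volumes of boxes determine Lebesgue measure.\<close>

lemma distr_PiM_lborel:
  fixes T :: "('i::finite \<Rightarrow> 'b::euclidean_space) \<Rightarrow> 'a::euclidean_space"
  assumes bij: "bij_betw \<beta> (UNIV \<times> Basis) Basis"
    and T: "\<And>f i b. b \<in> Basis \<Longrightarrow> T f \<bullet> \<beta> (i, b) = f i \<bullet> b"
  shows "T \<in> borel_measurable (\<Pi>\<^sub>M i\<in>UNIV. lborel)"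
    and "distr (\<Pi>\<^sub>M i\<in>UNIV. lborel) borel T = lborel"
proof -
  interpret product_sigma_finite "\<lambda>_::'i. lborel :: 'b measure" ..
  have ex: "\<exists>i b. b \<in> Basis \<and> e = \<beta> (i, b)" if "e \<in> Basis" for e
  proof -
    have "e \<in> \<beta> ` (UNIV \<times> Basis)" using bij that by (simp add: bij_betw_def)
    then show ?thesis by auto
  qed
  show T_meas: "T \<in> borel_measurable (\<Pi>\<^sub>M i\<in>UNIV. lborel)"
  proof (subst borel_measurable_euclidean_space, intro ballI)
    fix e :: 'a assume "e \<in> Basis"
    then obtain i b where "b \<in> Basis" "e = \<beta> (i, b)" using ex by blast
    then show "(\<lambda>f. T f \<bullet> e) \<in> borel_measurable (\<Pi>\<^sub>M i\<in>UNIV. lborel)"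
      by (simp add: T)
  qed
  have "lborel = distr (\<Pi>\<^sub>M i\<in>UNIV. lborel) borel T"
  proof (rule lborel_eqI)
    fix l u :: 'a assume le: "\<And>b. b \<in> Basis \<Longrightarrow> l \<bullet> b \<le> u \<bullet> b"
    \<comment> \<open>\<open>c w i\<close> is the part of \<open>w\<close> that belongs to the
      factor \<open>i\<close>; it supplies the corners of the box in that factor.\<close>
    define c where "c w i = (\<Sum>b\<in>Basis. (w \<bullet> \<beta> (i, b)) *\<^sub>R b)" for w i
    have c: "c w i \<bullet> b = w \<bullet> \<beta> (i, b)" if "b \<in> Basis" for w i b
      using that by (simp add: c_def inner_sum_left inner_Basis if_distrib cong: if_cong)
    have \<beta>: "\<beta> (i, b) \<in> Basis" if "b \<in> Basis" for i b
      using bij that by (auto simp: bij_betw_def)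
    have "T f \<in> box l u \<longleftrightarrow> (\<forall>i. f i \<in> box (c l i) (c u i))" for f
    proof -
      have "T f \<in> box l u \<longleftrightarrow> (\<forall>i. \<forall>b\<in>Basis. l \<bullet> \<beta> (i, b) < T f \<bullet> \<beta> (i, b) \<and> T f \<bullet> \<beta> (i, b) < u \<bullet> \<beta> (i, b))"
        unfolding mem_box using ex \<beta> by metis
      then show ?thesis by (simp add: mem_box T c)
    qed
    then have "T -` box l u \<inter> space (\<Pi>\<^sub>M i\<in>UNIV. lborel) = Pi\<^sub>E UNIV (\<lambda>i. box (c l i) (c u i))"
      by (auto simp: space_PiM)
    then have "emeasure (distr (\<Pi>\<^sub>M i\<in>UNIV. lborel) borel T) (box l u) =
        (\<Prod>i\<in>UNIV. emeasure lborel (box (c l i) (c u i)))"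
      by (simp add: emeasure_distr T_meas emeasure_PiM)
    also have "\<dots> = (\<Prod>i\<in>UNIV. \<Prod>b\<in>Basis. ennreal ((u - l) \<bullet> \<beta> (i, b)))"
      using le \<beta> by (intro prod.cong refl, subst emeasure_lborel_box)
        (auto simp: c inner_diff_left prod_ennreal)
    also have "\<dots> = (\<Prod>p\<in>UNIV \<times> Basis. ennreal ((u - l) \<bullet> \<beta> p))"
      by (simp add: prod.cartesian_product case_prod_beta')
    also have "\<dots> = (\<Prod>e\<in>Basis. ennreal ((u - l) \<bullet> e))"
      by (rule prod.reindex_bij_betw[OF bij])
    finally show "emeasure (distr (\<Pi>\<^sub>M i\<in>UNIV. lborel) borel T) (box l u) = ennreal (\<Prod>e\<in>Basis. (u - l) \<bullet> e)"
      using le by (simp add: prod_ennreal inner_diff_left)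
  qed simp
  then show "distr (\<Pi>\<^sub>M i\<in>UNIV. lborel) borel T = lborel" by simp
qed

lemma borel_measurable_vec_lambda [measurable (raw)]:
  fixes f :: "'a \<Rightarrow> 'i::finite \<Rightarrow> 'b::euclidean_space"
  assumes "\<And>i. (\<lambda>x. f x i) \<in> borel_measurable M"
  shows "(\<lambda>x. \<chi> i. f x i) \<in> borel_measurable M"
proof (subst borel_measurable_euclidean_space, intro ballI)
  fix e :: "'b ^ 'i" assume "e \<in> Basis"
  then obtain i b where "e = axis i b" by (auto simp: Basis_vec_def)
  then show "(\<lambda>x. (\<chi> i. f x i) \<bullet> e) \<in> borel_measurable M"
    using assms[of i] by (simp add: inner_axis)
qed

lemma borel_measurable_vec_nth [measurable (raw)]:
  fixes f :: "'a \<Rightarrow> 'b::euclidean_space ^ 'i::finite"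
  assumes "f \<in> borel_measurable M"
  shows "(\<lambda>x. f x $ i) \<in> borel_measurable M"
  using assms by (rule borel_measurable_continuous_on[rotated]) (intro continuous_intros)

lemma borel_measurable_det [measurable (raw)]:
  fixes f :: "'a \<Rightarrow> real ^ 'i::finite ^ 'i"
  assumes [measurable]: "f \<in> borel_measurable M"
  shows "(\<lambda>x. det (f x)) \<in> borel_measurable M"
  unfolding det_def by measurable

lemma borel_measurable_matrix_vector_mult [measurable (raw)]:
  fixes f :: "'a \<Rightarrow> real ^ 'i::finite ^ 'j::finite"
  assumes [measurable]: "f \<in> borel_measurable M" "g \<in> borel_measurable M"
  shows "(\<lambda>x. f x *v g x) \<in> borel_measurable M"
  unfolding matrix_vector_mult_def by measurable

lemma distr_PiM_lborel_permute:
  assumes "\<pi> permutes UNIV"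
  shows "(\<lambda>y. \<chi> i. y (\<pi> i)) \<in> borel_measurable (\<Pi>\<^sub>M i\<in>UNIV. (lborel :: real measure))"
    and "distr (\<Pi>\<^sub>M i\<in>UNIV. lborel) borel (\<lambda>y. \<chi> i. y (\<pi> i)) = (lborel :: (real ^ 'n::finite) measure)"
proof -
  \<comment> \<open>The inverse appears because position \<open>k\<close> of the vector holds
    \<open>y (\<pi> k)\<close>, so the coordinate \<open>y i\<close> lands at
    \<open>inv \<pi> i\<close>.\<close>
  let ?\<beta> = "\<lambda>(i, b :: real). axis (inv \<pi> i) b"
  have "inj_on ?\<beta> (UNIV \<times> Basis)"
    by (auto intro!: inj_onI simp: axis_eq_axis inj_eq[OF permutes_inj[OF permutes_inv[OF assms]]])
  moreover have "?\<beta> ` (UNIV \<times> Basis) = Basis"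
  proof -
    have "?\<beta> ` (UNIV \<times> Basis) = (\<lambda>i. axis i 1) ` range (inv \<pi>)" by auto
    also have "range (inv \<pi>) = UNIV" by (rule permutes_surj[OF permutes_inv[OF assms]])
    finally show ?thesis by (auto simp: Basis_vec_def)
  qed
  ultimately have bij: "bij_betw ?\<beta> (UNIV \<times> Basis) Basis" by (simp add: bij_betw_def)
  have "(\<chi> i. y (\<pi> i)) \<bullet> ?\<beta> (i, b) = y i \<bullet> b" for y :: "'n \<Rightarrow> real" and i b
    using permutes_inverses(1)[OF assms] by (simp add: inner_axis)
  note * = distr_PiM_lborel[OF bij this]
  show "(\<lambda>y. \<chi> i. y (\<pi> i)) \<in> borel_measurable (\<Pi>\<^sub>M i\<in>UNIV. (lborel :: real measure))"
    and "distr (\<Pi>\<^sub>M i\<in>UNIV. lborel) borel (\<lambda>y. \<chi> i. y (\<pi> i)) = (lborel :: (real ^ 'n::finite) measure)"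
    by (rule *)+
qed

text \<open>The product measure may be read into the vector in any order; comparing two orders
  settles the elementary matrices that swap coordinates.\<close>

lemma nn_integral_lborel_permute:
  fixes f :: "real ^ 'n::finite \<Rightarrow> ennreal"
  assumes f: "f \<in> borel_measurable borel" and \<pi>: "\<pi> permutes UNIV"
  shows "(\<integral>\<^sup>+x. f x \<partial>lborel) = (\<integral>\<^sup>+y. f (\<chi> i. y (\<pi> i)) \<partial>(\<Pi>\<^sub>M i\<in>UNIV. lborel))"
  using nn_integral_distr[OF distr_PiM_lborel_permute(1)[OF \<pi>], of f] f
  unfolding distr_PiM_lborel_permute(2)[OF \<pi>] by simp

lemmas nn_integral_lborel_vec = nn_integral_lborel_permute[OF _ permutes_id, unfolded id_apply]

text \<open>Integrating over the coordinate \<open>m\<close> on the inside, with the others fixed,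
  turns the shear into a translation of the line.\<close>

lemma nn_integral_lborel_vec_shear:
  fixes f :: "real ^ 'n::finite \<Rightarrow> ennreal"
  assumes [measurable]: "f \<in> borel_measurable borel" and mn: "m \<noteq> n"
  shows "(\<integral>\<^sup>+x. f (\<chi> i. if i = m then x $ m + x $ n else x $ i) \<partial>lborel) = (\<integral>\<^sup>+x. f x \<partial>lborel)"
proof -
  interpret product_sigma_finite "\<lambda>_::'n. lborel :: real measure" ..
  have U: "UNIV = insert m (UNIV - {m})" by auto
  let ?s = "\<lambda>x :: real ^ 'n. \<chi> i. if i = m then x $ m + x $ n else x $ i"
  have s[measurable]: "?s \<in> borel_measurable borel" by measurable
  have I: "(\<integral>\<^sup>+x. h x \<partial>lborel) = (\<integral>\<^sup>+y. \<integral>\<^sup>+t. h (\<chi> i. (y(m := t)) i) \<partial>lborel \<partial>(\<Pi>\<^sub>M i\<in>UNIV - {m}. lborel))"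
    if [measurable]: "h \<in> borel_measurable borel" for h :: "real ^ 'n \<Rightarrow> ennreal"
  proof -
    have "(\<lambda>y. h (\<chi> i. y i)) \<in> borel_measurable (\<Pi>\<^sub>M i\<in>insert m (UNIV - {m}). lborel)"
      unfolding U[symmetric] by measurable
    then show ?thesis
      unfolding nn_integral_lborel_vec[OF that] by (subst U, subst product_nn_integral_insert) auto
  qed
  have "(\<integral>\<^sup>+x. f (?s x) \<partial>lborel) =
      (\<integral>\<^sup>+y. \<integral>\<^sup>+t. f (\<chi> i. (y(m := y n + t)) i) \<partial>lborel \<partial>(\<Pi>\<^sub>M i\<in>UNIV - {m}. lborel))"
    by (subst I, measurable) (use mn in \<open>auto intro!: nn_integral_cong arg_cong[of _ _ f] simp: vec_eq_iff\<close>)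
  also have "\<dots> = (\<integral>\<^sup>+y. \<integral>\<^sup>+t. f (\<chi> i. (y(m := t)) i) \<partial>lborel \<partial>(\<Pi>\<^sub>M i\<in>UNIV - {m}. lborel))"
  proof (rule nn_integral_cong)
    fix y :: "'n \<Rightarrow> real"
    have "(\<lambda>t. f (\<chi> i. (y(m := t)) i)) \<in> borel_measurable borel"
      unfolding fun_upd_def by measurable
    from nn_integral_lborel_add[OF this, of "y n"]
    show "(\<integral>\<^sup>+t. f (\<chi> i. (y(m := y n + t)) i) \<partial>lborel) = (\<integral>\<^sup>+t. f (\<chi> i. (y(m := t)) i) \<partial>lborel)"
      by simp
  qed
  finally show ?thesis by (simp add: I)
qed

text \<open>\<open>measure_linear_image\<close> is unavailable: it assumes a well-ordered index type.\<close>

lemma nn_integral_lborel_matrix: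
  fixes A :: "real ^ 'n::finite ^ 'n"
  assumes "det A \<noteq> 0" and "f \<in> borel_measurable borel"
  shows "ennreal \<bar>det A\<bar> * (\<integral>\<^sup>+x. f (A *v x) \<partial>lborel) = (\<integral>\<^sup>+x. f x \<partial>lborel)"
proof -
  \<comment> \<open>The function is quantified inside \<open>P\<close> because the product case uses
    the hypothesis on \<open>B\<close> for \<open>f\<close> composed with \<open>A\<close>. The
    condition on the determinant is inside as well: a product is nonsingular only if both factors
    are, and a matrix with a zero row satisfies \<open>P\<close> vacuously.\<close>
  define P :: "real ^ 'n ^ 'n \<Rightarrow> bool" where "P A \<longleftrightarrow> (det A \<noteq> 0 \<longrightarrow> (\<forall>f\<in>borel_measurable borel.
    ennreal \<bar>det A\<bar> * (\<integral>\<^sup>+x. f (A *v x) \<partial>lborel) = (\<integral>\<^sup>+x. f x \<partial>lborel)))" for A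
  have "P A"
  proof (rule induct_matrix_elementary_alt)
    fix A B :: "real ^ 'n ^ 'n"
    assume A: "P A" and B: "P B"
    show "P (A ** B)"
      unfolding P_def
    proof (intro impI ballI)
      fix f :: "real ^ 'n \<Rightarrow> ennreal" assume [measurable]: "f \<in> borel_measurable borel"
      assume "det (A ** B) \<noteq> 0"
      then have "det A \<noteq> 0" "det B \<noteq> 0" by (auto simp: det_mul)
      moreover have "(\<lambda>x. f (A *v x)) \<in> borel_measurable borel" by measurable
      ultimately have "ennreal \<bar>det B\<bar> * (\<integral>\<^sup>+x. f (A *v (B *v x)) \<partial>lborel) = (\<integral>\<^sup>+x. f (A *v x) \<partial>lborel)"
        and "ennreal \<bar>det A\<bar> * (\<integral>\<^sup>+x. f (A *v x) \<partial>lborel) = (\<integral>\<^sup>+x. f x \<partial>lborel)"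
        using A B unfolding P_def by fastforce+
      then show "ennreal \<bar>det (A ** B)\<bar> * (\<integral>\<^sup>+x. f ((A ** B) *v x) \<partial>lborel) = (\<integral>\<^sup>+x. f x \<partial>lborel)"
        by (simp add: det_mul abs_mult ennreal_mult mult.assoc matrix_vector_mul_assoc)
    qed
  next
    fix A :: "real ^ 'n ^ 'n" and i assume "row i A = 0"
    then show "P A" by (simp add: P_def det_zero_row)
  next
    fix A :: "real ^ 'n ^ 'n" assume diag: "\<And>i j. i \<noteq> j \<Longrightarrow> A $ i $ j = 0"
    show "P A"
      unfolding P_def
    proof (intro impI ballI)
      fix f :: "real ^ 'n \<Rightarrow> ennreal" assume [measurable]: "f \<in> borel_measurable borel"
      assume det: "det A \<noteq> 0"
      define c where "c j = (A *v j) \<bullet> j" for j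
      have Ax: "A *v x = (\<chi> i. A $ i $ i * x $ i)" for x
      proof -
        have "(\<Sum>j\<in>UNIV. A $ i $ j * x $ j) = (\<Sum>j\<in>UNIV. if j = i then A $ i $ i * x $ i else 0)" for i
          using diag by (intro sum.cong) auto
        then show ?thesis by (simp add: matrix_vector_mult_def)
      qed
      have B: "Basis = (\<lambda>i::'n. axis i (1::real)) ` UNIV" by (auto simp: Basis_vec_def)
      have c: "c (axis i 1) = A $ i $ i" for i by (simp add: c_def Ax inner_axis)
      have inj: "inj (\<lambda>i::'n. axis i (1::real))" by (auto intro: injI simp: axis_eq_axis)
      have d: "det A = (\<Prod>i\<in>UNIV. A $ i $ i)" using diag by (rule det_diagonal)
      have sum: "(\<Sum>j\<in>Basis. (c j * (x \<bullet> j)) *\<^sub>R j) = A *v x" for x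
      proof -
        have "(\<Sum>j\<in>Basis. (c j * (x \<bullet> j)) *\<^sub>R j) = (\<Sum>i\<in>UNIV. (A $ i $ i * x $ i) *\<^sub>R axis i 1)"
          unfolding B by (subst sum.reindex[OF inj]) (simp add: c inner_axis)
        also have "\<dots> = A *v x"
          by (simp add: Ax vec_eq_iff axis_def if_distrib cong: if_cong)
        finally show ?thesis .
      qed
      have prod: "(\<Prod>j\<in>Basis. \<bar>c j\<bar>) = \<bar>det A\<bar>"
        unfolding B by (subst prod.reindex[OF inj]) (simp add: c d abs_prod)
      have "c j \<noteq> 0" if "j \<in> Basis" for j
        using that det by (auto simp: B c d)
      from lborel_affine_euclidean[of c 0, OF this]
      have "lborel = density (distr lborel borel (\<lambda>x. A *v x)) (\<lambda>_. ennreal \<bar>det A\<bar>)"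
        by (simp add: sum prod)
      then have "(\<integral>\<^sup>+x. f x \<partial>lborel) = (\<integral>\<^sup>+x. f x \<partial>density (distr lborel borel (\<lambda>x. A *v x)) (\<lambda>_. ennreal \<bar>det A\<bar>))"
        by simp
      also have "\<dots> = ennreal \<bar>det A\<bar> * (\<integral>\<^sup>+x. f (A *v x) \<partial>lborel)"
        by (simp add: nn_integral_density nn_integral_distr nn_integral_cmult)
      finally show "ennreal \<bar>det A\<bar> * (\<integral>\<^sup>+x. f (A *v x) \<partial>lborel) = (\<integral>\<^sup>+x. f x \<partial>lborel)" by simp
    qed
  next
    fix m n :: 'n assume "m \<noteq> n"
    let ?\<tau> = "Transposition.transpose m n"
    let ?A = "\<chi> i j. mat 1 $ i $ ?\<tau> j :: real ^ 'n ^ 'n"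
    have \<tau>: "?\<tau> permutes UNIV" by (rule permutes_swap_id) auto
    have "\<bar>det ?A\<bar> = 1"
      by (subst det_permute_columns[OF \<tau>]) (simp add: sign_def)
    moreover have "?A *v x = (\<chi> i. x $ ?\<tau> i)" for x
    proof -
      have "(\<Sum>j\<in>UNIV. ?A $ i $ j * x $ j) = (\<Sum>j\<in>UNIV. if j = ?\<tau> i then x $ j else 0)" for i
        by (intro sum.cong) (auto simp: mat_def)
      then show ?thesis by (simp add: matrix_vector_mult_def)
    qed
    moreover have "(\<integral>\<^sup>+x. f (\<chi> i. x $ ?\<tau> i) \<partial>lborel) = (\<integral>\<^sup>+x. f x \<partial>lborel)"
      if [measurable]: "f \<in> borel_measurable borel" for f :: "real ^ 'n \<Rightarrow> ennreal"
    proof -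
      have "(\<lambda>x. f (\<chi> i. x $ ?\<tau> i)) \<in> borel_measurable borel" by measurable
      then show ?thesis
        by (simp add: nn_integral_lborel_vec nn_integral_lborel_permute[OF that \<tau>])
    qed
    ultimately show "P ?A" by (simp add: P_def)
  next
    fix m n :: 'n assume mn: "m \<noteq> n"
    let ?A = "\<chi> i j. of_bool (i = m \<and> j = n \<or> i = j) :: real ^ 'n ^ 'n"
    have "?A = (\<chi> k. if k = m then row m (mat 1) + 1 *s row n (mat 1) else row k (mat 1))"
      using mn by (auto simp: vec_eq_iff row_def mat_def)
    then have "det ?A = 1" using det_row_operation[OF mn, of "mat 1" 1] by simp
    moreover have "?A *v x = (\<chi> i. if i = m then x $ m + x $ n else x $ i)" for x
    proof -
      have "(\<Sum>j\<in>UNIV. ?A $ i $ j * x $ j) = (\<Sum>j\<in>UNIV. (if j = i then x $ j else 0) + (if j = n then (if i = m then x $ j else 0) else 0))" for i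
        using mn by (intro sum.cong) auto
      then show ?thesis by (simp add: matrix_vector_mult_def sum.distrib vec_eq_iff)
    qed
    ultimately show "P ?A" by (simp add: P_def nn_integral_lborel_vec_shear[OF _ mn])
  qed
  then show ?thesis using assms by (auto simp: P_def)
qed

lemma nn_integral_lborel_affine:
  fixes A :: "real ^ 'n::finite ^ 'n"
  assumes "det A \<noteq> 0" and [measurable]: "f \<in> borel_measurable borel"
  shows "ennreal \<bar>det A\<bar> * (\<integral>\<^sup>+x. f (c + A *v x) \<partial>lborel) = (\<integral>\<^sup>+x. f x \<partial>lborel)"
proof -
  have "(\<lambda>x. f (c + x)) \<in> borel_measurable borel" by measurable
  from nn_integral_lborel_matrix[OF assms(1) this] show ?thesis
    by (simp add: nn_integral_lborel_add)
qed

section \<open>Determinants: the singular set and the affine matrix\<close>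

lemma finite_det_add_scalar_zeros:
  fixes u :: "real ^ 'n::finite ^ 'n"
  shows "finite {t. det (u + t *\<^sub>R mat 1) = 0}"
proof -
  \<comment> \<open>Leibniz's formula with linear polynomials as entries makes the determinant a
    polynomial in the shift.\<close>
  define p where "p = (\<Sum>\<pi> | \<pi> permutes (UNIV :: 'n set). of_int (sign \<pi>) *
    (\<Prod>i\<in>UNIV. [:u $ i $ \<pi> i, if i = \<pi> i then 1 else 0:]))"
  have poly: "poly p t = det (u + t *\<^sub>R mat 1)" for t
    unfolding p_def det_def
    by (auto simp: poly_sum poly_prod mat_def intro!: sum.cong prod.cong)
  \<comment> \<open>A bound for the operator norm shows that the polynomial is not zero: shifting by
    \<open>B + 1\<close> leaves a trivial kernel.\<close>
  obtain B where B: "\<And>x. norm (u *v x) \<le> B * norm x"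
    using linear_bounded[OF matrix_vector_mul_linear[of u]] by auto
  have "B \<ge> 0" using order_trans[OF norm_ge_zero B[of "axis undefined 1"]] by simp
  have "x = 0" if "(u + (B + 1) *\<^sub>R mat 1) *v x = 0" for x
  proof -
    have "u *v x = - ((B + 1) *\<^sub>R x)"
      using that by (simp add: matrix_vector_mult_add_rdistrib scaleR_matrix_vector_assoc[symmetric] eq_neg_iff_add_eq_0)
    then have "(B + 1) * norm x \<le> B * norm x" using B[of x] \<open>B \<ge> 0\<close> by simp
    then show ?thesis by (simp add: algebra_simps)
  qed
  then have "det (u + (B + 1) *\<^sub>R mat 1) \<noteq> 0"
    using matrix_left_invertible_ker[of "u + (B + 1) *\<^sub>R mat 1"]
    by (metis invertible_det_nz invertible_left_inverse)
  then have "p \<noteq> 0" using poly[of "B + 1"] by auto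
  then show ?thesis using poly_roots_finite[of p] by (simp add: poly)
qed

text \<open>By translation invariance the singular matrices \<open>u\<close> may be replaced by those with
  \<open>u + t I\<close> singular, and for fixed \<open>u\<close> this happens for finitely many \<open>t\<close> only.\<close>

lemma AE_det_nonzero: "AE u in lborel. det (u :: real ^ 'n::finite ^ 'n) \<noteq> 0"
proof -
  let ?i = "\<lambda>u :: real ^ 'n ^ 'n. indicator {u. det u = 0} u :: ennreal"
  have [measurable]: "{u :: real ^ 'n ^ 'n. det u = 0} \<in> sets borel" by measurable
  \<comment> \<open>The indicator of the unit interval has integral 1, so averaging over the shift
    introduces no constant.\<close>
  have "emeasure lborel {u :: real ^ 'n ^ 'n. det u = 0} = (\<integral>\<^sup>+t. indicator {0..1::real} t * (\<integral>\<^sup>+u. ?i u \<partial>lborel) \<partial>lborel)"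
    by (simp add: nn_integral_multc)
  also have "\<dots> = (\<integral>\<^sup>+t. \<integral>\<^sup>+u. indicator {0..1::real} t * ?i (t *\<^sub>R mat 1 + u) \<partial>lborel \<partial>lborel)"
    by (simp add: nn_integral_cmult nn_integral_lborel_add[of ?i])
  also have "\<dots> = (\<integral>\<^sup>+u. \<integral>\<^sup>+t. indicator {0..1::real} t * ?i (t *\<^sub>R mat 1 + u) \<partial>lborel \<partial>lborel)"
    by (rule lborel_pair.Fubini') measurable
  also have "\<dots> = (\<integral>\<^sup>+(u :: real ^ 'n ^ 'n). 0 \<partial>lborel)"
  proof (intro nn_integral_cong)
    fix u :: "real ^ 'n ^ 'n"
    have "(\<integral>\<^sup>+t. indicator {0..1::real} t * ?i (t *\<^sub>R mat 1 + u) \<partial>lborel) \<le>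
        (\<integral>\<^sup>+t. indicator {t. det (u + t *\<^sub>R mat 1) = 0} t \<partial>lborel)"
      by (intro nn_integral_mono) (auto simp: indicator_def add.commute)
    also have "\<dots> = 0"
      using finite_imp_null_set_lborel[OF finite_det_add_scalar_zeros[of u]] by auto
    finally show "(\<integral>\<^sup>+t. indicator {0..1::real} t * ?i (t *\<^sub>R mat 1 + u) \<partial>lborel) = 0" by simp
  qed
  finally have "{u :: real ^ 'n ^ 'n. det u = 0} \<in> null_sets lborel" by (simp add: null_sets_def)
  then show ?thesis by (rule AE_I') auto
qed

text \<open>This is the expansion along the row \<open>None\<close>. Every permutation is a
  transposition of \<open>None\<close> with some \<open>b\<close> after a permutation fixing
  \<open>None\<close>; it reads the entry in row \<open>None\<close> and column \<open>b\<close>,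
  which vanishes unless \<open>b = None\<close>.\<close>

lemma det_option_block:
  fixes A :: "real ^ 'm::finite option ^ 'm option"
  assumes A: "\<And>j. A $ None $ j = (if j = None then 1 else 0)"
  shows "det A = det (\<chi> i j. A $ Some i $ Some j)"
proof -
  let ?S = "range (Some :: 'm \<Rightarrow> 'm option)"
  let ?f = "\<lambda>p. of_int (sign p) * (\<Prod>i\<in>UNIV. A $ i $ p i)"
  \<comment> \<open>\<open>?h\<close> extends a permutation of the inner index type by fixing
    \<open>None\<close>, which preserves its sign.\<close>
  let ?h = "map_permutation UNIV (Some :: 'm \<Rightarrow> 'm option)"
  have U: "UNIV = insert None ?S" by (auto simp: UNIV_option_conv)
  have h: "?h p (Some i) = Some (p i)" "?h p None = None" for p i
    by (auto simp: map_permutation_def restrict_id_def)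
  have "det A = (\<Sum>b\<in>insert None ?S. \<Sum>q | q permutes ?S. ?f (Transposition.transpose None b \<circ> q))"
    unfolding det_def by (subst U, rule sum_over_permutations_insert) auto
  also have "\<dots> = (\<Sum>b\<in>insert None ?S. if b = None then \<Sum>q | q permutes ?S. ?f q else 0)"
  proof (intro sum.cong refl)
    fix b
    show "(\<Sum>q | q permutes ?S. ?f (Transposition.transpose None b \<circ> q)) = (if b = None then \<Sum>q | q permutes ?S. ?f q else 0)"
    proof (cases "b = None")
      case False
      have "(\<Prod>i\<in>UNIV. A $ i $ (Transposition.transpose None b \<circ> q) i) = 0" if "q permutes ?S" for q
      proof (rule prod_zero)
        have "q None = None" using that by (auto simp: permutes_def)
        then show "\<exists>i\<in>UNIV. A $ i $ (Transposition.transpose None b \<circ> q) i = 0"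
          using False A by (intro bexI[of _ None]) auto
      qed simp
      then show ?thesis using False by (auto intro!: sum.neutral)
    qed simp
  qed
  also have "\<dots> = (\<Sum>q | q permutes ?S. ?f q)"
    by (subst sum.delta) auto
  also have "\<dots> = (\<Sum>p | p permutes (UNIV :: 'm set). ?f (?h p))"
  proof -
    have "bij_betw (Some :: 'm \<Rightarrow> 'm option) UNIV ?S" by (simp add: bij_betw_def)
    from bij_betw_permutations[OF this]
    have "bij_betw ?h {p. p permutes UNIV} {q. q permutes ?S}"
      by (rule bij_betw_cong[THEN iffD1, rotated]) (auto simp: map_permutation_def restrict_id_def fun_eq_iff)
    then show ?thesis by (rule sum.reindex_bij_betw[symmetric])
  qed
  also have "\<dots> = (\<Sum>p | p permutes (UNIV :: 'm set). of_int (sign p) * (\<Prod>i\<in>UNIV. A $ Some i $ Some (p i)))"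
  proof (intro sum.cong refl)
    fix p assume "p \<in> {p. p permutes (UNIV :: 'm set)}"
    then have "sign (?h p) = sign p" by (intro sign_map_permutation) auto
    moreover have "(\<Prod>i\<in>UNIV. A $ i $ ?h p i) = (\<Prod>i\<in>UNIV. A $ Some i $ Some (p i))"
      by (subst U, subst prod.insert) (auto simp: prod.reindex h A)
    ultimately show "?f (?h p) = of_int (sign p) * (\<Prod>i\<in>UNIV. A $ Some i $ Some (p i))" by simp
  qed
  finally show ?thesis by (simp add: det_def)
qed

text \<open>Subtracting the column \<open>None\<close> from all others turns the row of ones into a
  unit row, so the determinant reduces to the block of differences. Rows and columns share their
  index type, hence even the signs agree.\<close>

lemma det_affine_matrix:
  "det (affine_matrix \<xi>) = det (\<chi> i j. (\<xi> (Some i) - \<xi> None) $ j)"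
proof -
  \<comment> \<open>Right multiplication by \<open>E\<close> performs all the column subtractions at
    once.\<close>
  define E :: "real ^ 'a option ^ 'a option" where
    "E = (\<chi> r k. (if r = k then 1 else 0) - (if r = None \<and> k \<noteq> None then 1 else 0))"
  let ?P = "affine_matrix \<xi> ** E"
  have sum_None: "(\<Sum>k\<in>UNIV. f k * E $ k $ j) = (case j of None \<Rightarrow> f None | Some i \<Rightarrow> f (Some i) - f None)"
    for f :: "'a option \<Rightarrow> real" and j
  proof -
    have "(\<Sum>k\<in>UNIV. f k * E $ k $ j) = (\<Sum>k\<in>UNIV. if k = j then f k else 0) - (\<Sum>k\<in>UNIV. if k = None then (if j \<noteq> None then f k else 0) else 0)"
      unfolding sum_subtractf[symmetric] by (intro sum.cong) (auto simp: E_def)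
    then show ?thesis by (auto split: option.split)
  qed
  have P: "?P $ r $ j = (case j of None \<Rightarrow> affine_matrix \<xi> $ r $ None
      | Some i \<Rightarrow> affine_matrix \<xi> $ r $ Some i - affine_matrix \<xi> $ r $ None)" for r j
    by (simp add: matrix_matrix_mult_def sum_None)
  \<comment> \<open>It is the column \<open>None\<close> of \<open>E\<close> that is a unit vector,
    so the expansion applies to the transpose.\<close>
  have "det (transpose E) = det (\<chi> i j. transpose E $ Some i $ Some j)"
    by (rule det_option_block) (auto simp: transpose_def E_def)
  also have "(\<chi> i j. transpose E $ Some i $ Some j) = (mat 1 :: real ^ 'a ^ 'a)"
    by (auto simp: transpose_def E_def mat_def vec_eq_iff)
  finally have "det E = 1" by simp
  then have "det (affine_matrix \<xi>) = det ?P" by (simp add: det_mul)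
  also have "\<dots> = det (\<chi> i j. ?P $ Some i $ Some j)"
    by (rule det_option_block, unfold P) (auto simp: affine_matrix_def split: option.split)
  also have "(\<chi> i j. ?P $ Some i $ Some j) = transpose (\<chi> i j. (\<xi> (Some i) - \<xi> None) $ j)"
    by (unfold P) (simp add: transpose_def affine_matrix_def vec_eq_iff)
  finally show ?thesis by simp
qed

section \<open>Shears, products of completed measures and Borel representatives\<close>

lemma borel_measurable_shear:
  fixes c :: "'b::euclidean_space \<Rightarrow> 'a::euclidean_space"
  assumes "c \<in> borel_measurable borel"
  shows "(\<lambda>(u, v). (u + c v, v)) \<in> borel_measurable (borel :: ('a \<times> 'b) measure)"
proof -
  have fs: "fst \<in> borel_measurable (borel :: ('a \<times> 'b) measure)" "snd \<in> borel_measurable (borel :: ('a \<times> 'b) measure)"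
    by (auto intro!: borel_measurable_continuous_onI continuous_intros)
  show ?thesis
    unfolding case_prod_beta'
    by (intro borel_measurable_Pair borel_measurable_add fs measurable_compose[OF fs(2)] assms)
qed

text \<open>For fixed second component the map is a translation of the first, so Tonelli and
  translation invariance suffice.\<close>

lemma distr_lborel_shear:
  fixes c :: "'b::euclidean_space \<Rightarrow> 'a::euclidean_space"
  assumes [measurable]: "c \<in> borel_measurable borel"
  shows "distr lborel borel (\<lambda>(u, v). (u + c v, v)) = (lborel :: ('a \<times> 'b) measure)"
proof (rule measure_eqI)
  fix S :: "('a \<times> 'b) set"
  assume "S \<in> sets (distr lborel borel (\<lambda>(u, v). (u + c v, v)))"
  then have [measurable]: "S \<in> sets borel" by simp
  have shear: "(\<lambda>(u, v). (u + c v, v)) \<in> borel_measurable (lborel :: ('a \<times> 'b) measure)"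
    using borel_measurable_shear[OF assms] by simp
  let ?i = "indicator S :: 'a \<times> 'b \<Rightarrow> ennreal"
  have "emeasure (distr lborel borel (\<lambda>(u, v). (u + c v, v))) S = (\<integral>\<^sup>+p. ?i (fst p + c (snd p), snd p) \<partial>(lborel :: ('a \<times> 'b) measure))"
  proof -
    have "emeasure (distr lborel borel (\<lambda>(u, v). (u + c v, v))) S = (\<integral>\<^sup>+p. ?i p \<partial>distr lborel borel (\<lambda>(u, v). (u + c v, v)))"
      by simp
    then show ?thesis
      by (subst (asm) nn_integral_distr[OF shear]) (auto simp: case_prod_beta')
  qed
  also have "\<dots> = (\<integral>\<^sup>+v. \<integral>\<^sup>+u. ?i (c v + u, v) \<partial>lborel \<partial>lborel)"
    unfolding lborel_prod[symmetric] by (subst lborel_pair.nn_integral_snd[symmetric]) (auto simp: add.commute)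
  also have "\<dots> = (\<integral>\<^sup>+v. \<integral>\<^sup>+u. ?i (u, v) \<partial>lborel \<partial>lborel)"
    by (intro nn_integral_cong nn_integral_lborel_add[of "\<lambda>u. ?i (u, _)"]) measurable
  also have "\<dots> = (\<integral>\<^sup>+p. ?i p \<partial>(lborel \<Otimes>\<^sub>M lborel))"
    by (subst lborel_pair.nn_integral_snd) (auto simp: lborel_prod)
  also have "\<dots> = emeasure lborel S" by (simp add: lborel_prod)
  finally show "emeasure (distr lborel borel (\<lambda>(u, v). (u + c v, v))) S = emeasure lborel S" .
qed simp

lemma sigma_finite_lebesgue: "sigma_finite_measure (lebesgue :: 'a::euclidean_space measure)"
proof -
  obtain A :: "'a set set" where A: "countable A" "A \<subseteq> sets lborel" "\<Union>A = space lborel" "\<forall>a\<in>A. emeasure lborel a \<noteq> \<infinity>"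
    using lborel.sigma_finite_countable by auto
  then show ?thesis
    by unfold_locales (auto intro!: exI[of _ A] simp: emeasure_completion)
qed

text \<open>The identity is measurable from the product of completions to the Borel product. Its
  image measure agrees with the Borel product on rectangles and hence everywhere.\<close>

lemma nn_integral_PiM_lebesgue:
  fixes f :: "('i::finite \<Rightarrow> 'a::euclidean_space) \<Rightarrow> ennreal"
  assumes [measurable]: "f \<in> borel_measurable (\<Pi>\<^sub>M i\<in>UNIV. lborel)"
  shows "(\<integral>\<^sup>+x. f x \<partial>(\<Pi>\<^sub>M i\<in>UNIV. lebesgue)) = (\<integral>\<^sup>+x. f x \<partial>(\<Pi>\<^sub>M i\<in>UNIV. lborel))"
proof -
  let ?L = "\<Pi>\<^sub>M i\<in>(UNIV :: 'i set). (lebesgue :: 'a measure)"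
  let ?B = "\<Pi>\<^sub>M i\<in>(UNIV :: 'i set). (lborel :: 'a measure)"
  interpret B: product_sigma_finite "\<lambda>_::'i. lborel :: 'a measure" ..
  interpret L: product_sigma_finite "\<lambda>_::'i. lebesgue :: 'a measure"
    by (simp add: product_sigma_finite_def sigma_finite_lebesgue)
  have id: "(\<lambda>x. x) \<in> measurable ?L ?B"
  proof (rule measurable_PiM_single')
    show "(\<lambda>x. x i) \<in> measurable ?L lborel" for i
      using measurable_compose[OF measurable_component_singleton[of i UNIV "\<lambda>_. lebesgue"]
        measurable_completion[OF measurable_ident, of lborel]] by simp
  qed auto
  have "?B = distr ?L ?B (\<lambda>x. x)"
  proof (rule B.PiM_eqI[symmetric])
    fix A :: "'i \<Rightarrow> 'a set" assume A: "\<And>i. i \<in> UNIV \<Longrightarrow> A i \<in> sets lborel"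
    then have "Pi\<^sub>E UNIV A \<in> sets ?B" by (intro sets_PiM_I_finite) auto
    then have "emeasure (distr ?L ?B (\<lambda>x. x)) (Pi\<^sub>E UNIV A) = emeasure ?L (Pi\<^sub>E UNIV A)"
      by (subst emeasure_distr[OF id]) (auto simp: space_PiM)
    also have "\<dots> = (\<Prod>i\<in>UNIV. emeasure lborel (A i))"
      using A by (subst L.emeasure_PiM) (auto simp: emeasure_completion)
    finally show "emeasure (distr ?L ?B (\<lambda>x. x)) (Pi\<^sub>E UNIV A) = (\<Prod>i\<in>UNIV. emeasure lborel (A i))" .
  qed auto
  then have "(\<integral>\<^sup>+x. f x \<partial>?B) = (\<integral>\<^sup>+x. f x \<partial>distr ?L ?B (\<lambda>x. x))" by simp
  also have "\<dots> = (\<integral>\<^sup>+x. f x \<partial>?L)"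
    by (rule nn_integral_distr[OF id]) simp
  finally show ?thesis by simp
qed

text \<open>The exceptional set lies in a cylinder over a null set, whose measure is a product with
  a zero factor.\<close>

lemma AE_PiM_lebesgue_component:
  fixes P :: "'a::euclidean_space \<Rightarrow> bool" and i :: "'i::finite"
  assumes "AE x in lebesgue. P x"
  shows "AE x in (\<Pi>\<^sub>M i\<in>(UNIV :: 'i set). lebesgue). P (x i)"
proof -
  interpret L: product_sigma_finite "\<lambda>_::'i. lebesgue :: 'a measure"
    by (simp add: product_sigma_finite_def sigma_finite_lebesgue)
  obtain N where N: "{x \<in> space lebesgue. \<not> P x} \<subseteq> N" "emeasure lebesgue N = 0" "N \<in> sets lebesgue"
    using AE_E[OF assms] by auto
  let ?E = "Pi\<^sub>E UNIV (\<lambda>j. if j = i then N else UNIV)"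
  have "emeasure (\<Pi>\<^sub>M i\<in>UNIV. lebesgue) ?E = (\<Prod>j\<in>UNIV. emeasure lebesgue (if j = i then N else UNIV))"
    using N by (intro L.emeasure_PiM) auto
  also have "\<dots> = 0"
    using N(2) by (intro prod_zero) (auto intro!: bexI[of _ i])
  finally have "?E \<in> null_sets (\<Pi>\<^sub>M i\<in>UNIV. lebesgue)"
    using N(3) by (intro null_setsI) (auto intro!: sets_PiM_I_finite)
  then show ?thesis
    by (rule AE_I') (use N(1) in auto)
qed

text \<open>Borel measurability survives composition with the later changes of variables. Real and
  imaginary parts are modified separately on null sets.\<close>

lemma integrable_lebesgue_borel_version:
  fixes g :: "'a::euclidean_space \<Rightarrow> complex"
  assumes g: "integrable lebesgue g"
  obtains g' where "integrable lborel g'" "AE x in lebesgue. g x = g' x"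
proof -
  have m: "(\<lambda>x. Re (g x)) \<in> borel_measurable lebesgue" "(\<lambda>x. Im (g x)) \<in> borel_measurable lebesgue"
    using g by auto
  obtain r where r: "r \<in> borel_measurable lborel" "AE x in lborel. Re (g x) = r x"
    using completion_ex_borel_measurable_real[OF m(1)] by auto
  obtain s where s: "s \<in> borel_measurable lborel" "AE x in lborel. Im (g x) = s x"
    using completion_ex_borel_measurable_real[OF m(2)] by auto
  define g' where "g' x = Complex (r x) (s x)" for x
  have g'm: "g' \<in> borel_measurable lborel"
    unfolding g'_def Complex_eq using r(1) s(1) by measurable
  have ae: "AE x in lebesgue. g x = g' x"
  proof (rule AE_completion, use r(2) s(2) in eventually_elim)
    case (elim x)
    then show ?case by (simp add: g'_def complex_eq_iff)
  qed
  have "integrable lebesgue g'"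
    by (rule integrable_cong_AE_imp[OF g measurable_completion[OF g'm] ae])
  then have "integrable lborel g'"
    using g'm by (simp add: integrable_completion)
  then show ?thesis using ae that by blast
qed

lemma paraboloid_extension_lborel:
  assumes "integrable lborel g'" "AE \<xi> in lebesgue. g \<xi> = g' \<xi>" "g \<in> borel_measurable lebesgue"
  shows "paraboloid_extension g x = (\<integral>\<xi>. cis (fst x \<bullet> \<xi> + snd x * (norm \<xi>)\<^sup>2) * g' \<xi> \<partial>lborel)"
proof -
  have [measurable]: "g' \<in> borel_measurable borel" using assms(1) by auto
  have m: "(\<lambda>\<xi>. cis (fst x \<bullet> \<xi> + snd x * (norm \<xi>)\<^sup>2) * g' \<xi>) \<in> borel_measurable lborel"
    by measurable
  have c: "(\<lambda>\<xi>. cis (fst x \<bullet> \<xi> + snd x * (norm \<xi>)\<^sup>2)) \<in> borel_measurable lebesgue"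
    by (rule measurable_completion) measurable
  have "paraboloid_extension g x = (\<integral>\<xi>. cis (fst x \<bullet> \<xi> + snd x * (norm \<xi>)\<^sup>2) * g \<xi> \<partial>lebesgue)"
    by (simp add: paraboloid_extension_def cis_conv_exp)
  also have "\<dots> = (\<integral>\<xi>. cis (fst x \<bullet> \<xi> + snd x * (norm \<xi>)\<^sup>2) * g' \<xi> \<partial>lebesgue)"
    using assms(2) borel_measurable_times[OF c assms(3)] measurable_completion[OF m]
    by (intro integral_cong_AE) auto
  also have "\<dots> = (\<integral>\<xi>. cis (fst x \<bullet> \<xi> + snd x * (norm \<xi>)\<^sup>2) * g' \<xi> \<partial>lborel)"
    by (rule integral_completion[OF m])
  finally show ?thesis .
qed

section \<open>Coordinates for the tuples of points and of frequencies\<close>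

lemma distr_PiM_lborel_pairs:
  fixes T :: "('m::finite \<Rightarrow> (real ^ 'm) \<times> real) \<Rightarrow> (real ^ 'm ^ 'm) \<times> (real ^ 'm)"
  defines "T \<equiv> \<lambda>x. (\<chi> i. fst (x i), \<chi> i. snd (x i))"
  shows "T \<in> borel_measurable (\<Pi>\<^sub>M i\<in>UNIV. lborel)" and "distr (\<Pi>\<^sub>M i\<in>UNIV. lborel) borel T = lborel"
proof -
  \<comment> \<open>A basis element \<open>(a, b)\<close> of the product has one zero component, and
    \<open>axis i 0 = 0\<close>, so its image is again a basis element.\<close>
  let ?\<beta> = "\<lambda>(i, a, b). (axis i a, axis i b) :: (real ^ 'm ^ 'm) \<times> (real ^ 'm)"
  have "inj_on ?\<beta> (UNIV \<times> Basis)"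
    by (auto intro!: inj_onI simp: axis_eq_axis Basis_prod_def)
  moreover have "?\<beta> ` (UNIV \<times> Basis) = Basis"
    by (auto simp: Basis_prod_def Basis_vec_def image_Un image_iff) blast+
  ultimately have bij: "bij_betw ?\<beta> (UNIV \<times> Basis) Basis" by (simp add: bij_betw_def)
  have "T x \<bullet> ?\<beta> (i, b) = x i \<bullet> b" for x i b
    by (cases b) (simp add: T_def inner_axis inner_prod_def)
  note * = distr_PiM_lborel[OF bij this]
  show "T \<in> borel_measurable (\<Pi>\<^sub>M i\<in>UNIV. lborel)" "distr (\<Pi>\<^sub>M i\<in>UNIV. lborel) borel T = lborel"
    by (rule *)+
qed

text \<open>The map is a relabelling of coordinates followed by a shear that subtracts the last
  vector from every row, so its Jacobian is 1.\<close>

lemma distr_PiM_lborel_differences: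
  fixes T :: "('m::finite option \<Rightarrow> real ^ 'm) \<Rightarrow> (real ^ 'm ^ 'm) \<times> (real ^ 'm)"
  defines "T \<equiv> \<lambda>\<xi>. (\<chi> i. \<xi> (Some i) - \<xi> None, \<xi> None)"
  shows "T \<in> borel_measurable (\<Pi>\<^sub>M i\<in>UNIV. lborel)" and "distr (\<Pi>\<^sub>M i\<in>UNIV. lborel) borel T = lborel"
proof -
  let ?\<beta> = "\<lambda>(j, b). (case j of None \<Rightarrow> (0, b) | Some i \<Rightarrow> (axis i b, 0)) :: (real ^ 'm ^ 'm) \<times> (real ^ 'm)"
  let ?T = "\<lambda>\<xi> :: 'm option \<Rightarrow> real ^ 'm. (\<chi> i. \<xi> (Some i), \<xi> None)"
  let ?S = "\<lambda>(u :: real ^ 'm ^ 'm, v). (u + (\<chi> i. - v), v)"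
  have "inj_on ?\<beta> (UNIV \<times> Basis)"
    by (auto intro!: inj_onI simp: axis_eq_axis axis_eq_0_iff split: option.splits)
  moreover have "?\<beta> ` (UNIV \<times> Basis) = Basis"
    by (auto simp: Basis_prod_def Basis_vec_def[where 'b='m and 'a="real ^ 'm"] UNIV_option_conv image_iff)
      blast+
  ultimately have bij: "bij_betw ?\<beta> (UNIV \<times> Basis) Basis" by (simp add: bij_betw_def)
  have "?T x \<bullet> ?\<beta> (i, b) = x i \<bullet> b" for x i b
    by (auto simp: inner_axis inner_prod_def split: option.split)
  note * = distr_PiM_lborel[OF bij this]
  have c: "(\<lambda>v :: real ^ 'm. \<chi> i :: 'm. - v) \<in> borel_measurable borel" by measurable
  have S: "?S \<in> borel_measurable borel"
    using borel_measurable_shear[OF c] by simp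
  have TS: "T = ?S \<circ> ?T" by (auto simp: T_def fun_eq_iff vec_eq_iff)
  show "T \<in> borel_measurable (\<Pi>\<^sub>M i\<in>UNIV. lborel)"
    unfolding TS by (rule measurable_comp[OF *(1) S])
  have "distr (\<Pi>\<^sub>M i\<in>UNIV. lborel) borel T = distr (distr (\<Pi>\<^sub>M i\<in>UNIV. lborel) borel ?T) borel ?S"
    unfolding TS by (rule distr_distr[symmetric]) (use * S in auto)
  then show "distr (\<Pi>\<^sub>M i\<in>UNIV. lborel) borel T = lborel"
    by (simp only: *(2) distr_lborel_shear[OF c])
qed

lemma borel_measurable_fst_borel [measurable (raw)]:
  fixes f :: "'c \<Rightarrow> 'a::euclidean_space \<times> 'b::euclidean_space"
  shows "f \<in> borel_measurable M \<Longrightarrow> (\<lambda>x. fst (f x)) \<in> borel_measurable M"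
  by (erule borel_measurable_continuous_on[rotated]) (intro continuous_intros)

lemma borel_measurable_snd_borel [measurable (raw)]:
  fixes f :: "'c \<Rightarrow> 'a::euclidean_space \<times> 'b::euclidean_space"
  shows "f \<in> borel_measurable M \<Longrightarrow> (\<lambda>x. snd (f x)) \<in> borel_measurable M"
  by (erule borel_measurable_continuous_on[rotated]) (intro continuous_intros)

section \<open>The phase of the convolution\<close>

text \<open>The rows of the matrix \<open>fst q\<close> are the differences u_i, and
  \<open>snd q\<close> is \<eta>. The first component is kept, so the map is fibred over
  \<open>u\<close> and affine on each fibre.\<close>

definition phase :: "(real ^ 'm::finite ^ 'm) \<times> (real ^ 'm) \<Rightarrow> (real ^ 'm ^ 'm) \<times> (real ^ 'm)" where
  "phase q = (fst q, (\<chi> i. (norm (fst q $ i))\<^sup>2) + (2 *\<^sub>R fst q) *v snd q)"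

text \<open>Cramer's rule gives an inverse of \<open>phase\<close> that is visibly Borel measurable.\<close>

definition phase_inv :: "(real ^ 'm::finite ^ 'm) \<times> (real ^ 'm) \<Rightarrow> (real ^ 'm ^ 'm) \<times> (real ^ 'm)" where
  "phase_inv p = (fst p, \<chi> k. det (\<chi> i j. if j = k then snd p $ i - (norm (fst p $ i))\<^sup>2 else 2 * fst p $ i $ j)
     / det (2 *\<^sub>R fst p))"

text \<open>As \<open>u\<close> is kept, the Jacobian of the whole map is that of the affine map on
  the fibre.\<close>

definition phase_jac :: "(real ^ 'm::finite ^ 'm) \<times> (real ^ 'm) \<Rightarrow> real" where
  "phase_jac q = \<bar>det (2 *\<^sub>R fst q)\<bar>"

lemma det_scaleR: "det (c *\<^sub>R (A :: real ^ 'n::finite ^ 'n)) = c ^ CARD('n) * det A"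
proof -
  have "c *\<^sub>R A = (\<chi> i. c *s A $ i)" by (simp add: vec_eq_iff)
  then show ?thesis by (simp add: det_rows_mul)
qed

lemma phase_jac_eq: "phase_jac (q :: (real ^ 'm::finite ^ 'm) \<times> _) = 2 ^ CARD('m) * \<bar>det (fst q)\<bar>"
  by (simp add: phase_jac_def det_scaleR abs_mult)

lemma phase_jac_phase [simp]: "phase_jac (phase q) = phase_jac q"
  by (simp add: phase_jac_def phase_def)

text \<open>After removal of the squares |u_i|^2 there remains a linear system for \<eta> with
  matrix 2u, which Cramer's rule solves.\<close>

lemma phase_inv_phase:
  assumes "phase_jac q \<noteq> 0"
  shows "phase_inv (phase q) = q"
proof -
  have d: "det (2 *\<^sub>R fst q) \<noteq> 0" using assms by (simp add: phase_jac_def)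
  from cramer[OF d, THEN iffD1, OF refl, of "snd q"] show ?thesis
    by (simp add: phase_inv_def phase_def prod_eq_iff cong: if_cong)
qed

lemma borel_measurable_phase [measurable]: "phase \<in> borel_measurable borel"
  unfolding phase_def[abs_def] by (intro borel_measurable_Pair) measurable

lemma borel_measurable_phase_jac [measurable]: "phase_jac \<in> borel_measurable borel"
  unfolding phase_jac_def[abs_def] by measurable

lemma borel_measurable_phase_inv [measurable]: "phase_inv \<in> borel_measurable borel"
  unfolding phase_inv_def[abs_def] by (intro borel_measurable_Pair) measurable

lemma AE_phase_jac_nonzero: "AE q in lborel. phase_jac (q :: (real ^ 'm::finite ^ 'm) \<times> (real ^ 'm)) \<noteq> 0"
proof -
  have [measurable]: "{q :: (real ^ 'm ^ 'm) \<times> (real ^ 'm). phase_jac q = 0} \<in> sets borel" by measurable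
  have "emeasure lborel {q :: (real ^ 'm ^ 'm) \<times> (real ^ 'm). phase_jac q = 0} =
      (\<integral>\<^sup>+u. \<integral>\<^sup>+v. indicator {q. phase_jac q = 0} (u, v) \<partial>(lborel :: (real ^ 'm) measure) \<partial>(lborel :: (real ^ 'm ^ 'm) measure))"
    by (subst lborel.nn_integral_fst) (auto simp: lborel_prod)
  also have "\<dots> = (\<integral>\<^sup>+u. 0 \<partial>(lborel :: (real ^ 'm ^ 'm) measure))"
    by (rule nn_integral_cong_AE, use AE_det_nonzero in eventually_elim) (simp add: phase_jac_eq indicator_def)
  finally have "{q :: (real ^ 'm ^ 'm) \<times> (real ^ 'm). phase_jac q = 0} \<in> null_sets lborel" by (simp add: null_sets_def)
  then show ?thesis by (rule AE_I') auto
qed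

text \<open>This is the change of variables as an identity of measures. Integrating over the fibre
  first, almost every \<open>u\<close> gives an invertible affine map, so the fibre is covered
  exactly once and the weight cancels.\<close>

lemma distr_density_phase:
  "distr (density lborel (\<lambda>q. ennreal (phase_jac q))) borel phase = (lborel :: ((real ^ 'm::finite ^ 'm) \<times> (real ^ 'm)) measure)"
proof (rule measure_eqI)
  fix S :: "((real ^ 'm::finite ^ 'm) \<times> (real ^ 'm)) set"
  assume "S \<in> sets (distr (density lborel (\<lambda>q. ennreal (phase_jac q))) borel phase)"
  then have [measurable]: "S \<in> sets borel" by simp
  let ?i = "indicator S :: (real ^ 'm ^ 'm) \<times> (real ^ 'm) \<Rightarrow> ennreal"
  have "emeasure (distr (density lborel (\<lambda>q. ennreal (phase_jac q))) borel phase) S =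
      (\<integral>\<^sup>+q. ?i q \<partial>distr (density lborel (\<lambda>q. ennreal (phase_jac q))) borel phase)"
    by simp
  also have "\<dots> = (\<integral>\<^sup>+q. ennreal (phase_jac q) * ?i (phase q) \<partial>lborel)"
    by (subst nn_integral_distr) (auto simp: nn_integral_density)
  also have "\<dots> = (\<integral>\<^sup>+u. \<integral>\<^sup>+v. ennreal (phase_jac (u, v)) * ?i (phase (u, v)) \<partial>lborel \<partial>lborel)"
    by (subst lborel.nn_integral_fst) (auto simp: lborel_prod)
  also have "\<dots> = (\<integral>\<^sup>+u. \<integral>\<^sup>+v. ?i (u, v) \<partial>lborel \<partial>lborel)"
  proof (rule nn_integral_cong_AE, use AE_det_nonzero in eventually_elim)
    case (elim u)
    have d: "det (2 *\<^sub>R u) \<noteq> 0" using elim by (simp add: det_scaleR)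
    have m: "(\<lambda>v. ?i (u, v)) \<in> borel_measurable borel" by measurable
    have "(\<integral>\<^sup>+v. ennreal (phase_jac (u, v)) * ?i (phase (u, v)) \<partial>lborel) =
        ennreal \<bar>det (2 *\<^sub>R u)\<bar> * (\<integral>\<^sup>+v. ?i (u, (\<chi> i. (norm (u $ i))\<^sup>2) + (2 *\<^sub>R u) *v v) \<partial>lborel)"
      unfolding phase_jac_def phase_def fst_conv snd_conv by (rule nn_integral_cmult) measurable
    then show ?case by (simp only: nn_integral_lborel_affine[OF d m])
  qed
  also have "\<dots> = (\<integral>\<^sup>+q. ?i q \<partial>lborel)"
    by (subst lborel.nn_integral_fst) (auto simp: lborel_prod)
  also have "\<dots> = emeasure lborel S" by simp
  finally show "emeasure (distr (density lborel (\<lambda>q. ennreal (phase_jac q))) borel phase) S = emeasure lborel S" .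
qed simp

text \<open>The change of variables \<open>phase\<close> turns an oscillatory integral with this phase into the
  Fourier transform of a single integrable function.\<close>

lemma plancherel_phase:
  fixes A :: "(real ^ 'm::finite ^ 'm) \<times> (real ^ 'm) \<Rightarrow> complex"
  assumes A: "integrable lborel A"
  shows "(\<integral>\<^sup>+p. ennreal ((norm (\<integral>q. cis (p \<bullet> phase q) * A q \<partial>lborel))\<^sup>2) \<partial>lborel) =
    ennreal ((2 * pi) ^ (CARD('m) * (CARD('m) + 1))) * (\<integral>\<^sup>+q. ennreal ((norm (A q))\<^sup>2) / ennreal (phase_jac q) \<partial>lborel)"
proof -
  let ?D = "density (lborel :: ((real ^ 'm ^ 'm) \<times> (real ^ 'm)) measure) (\<lambda>q. ennreal (phase_jac q))"
  have [measurable]: "A \<in> borel_measurable borel" using A by auto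
  \<comment> \<open>\<open>H\<close> is the amplitude in the new coordinates. The Jacobian may be
    evaluated at \<open>p\<close>, since \<open>phase\<close> does not change it, and the value 0 is
    used only on the null set where it vanishes.\<close>
  define H where "H p = (if phase_jac p = 0 then 0 else A (phase_inv p) / of_real (phase_jac p))" for p
  have [measurable]: "H \<in> borel_measurable borel"
    unfolding H_def[abs_def] by measurable
  have phase_jac_nonneg: "phase_jac q \<ge> 0" for q :: "(real ^ 'm ^ 'm) \<times> (real ^ 'm)" by (simp add: phase_jac_def)
  have HA: "AE q in lborel. phase_jac q > 0 \<and> phase_jac q *\<^sub>R H (phase q) = A q"
    using AE_phase_jac_nonzero
  proof eventually_elim
    case (elim q)
    then show ?case using phase_jac_nonneg[of q]
      by (simp add: H_def phase_inv_phase scaleR_conv_of_real)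
  qed
  have phD: "phase \<in> measurable ?D borel" by simp
  have "integrable lborel (\<lambda>q. phase_jac q *\<^sub>R H (phase q))"
    by (rule integrable_cong_AE_imp[OF A]) (use HA in \<open>auto elim: eventually_mono\<close>)
  then have "integrable (distr ?D borel phase) H"
    by (subst integrable_distr_eq[OF phD]) (auto simp: integrable_density phase_jac_nonneg)
  then have H: "integrable lborel H" by (simp add: distr_density_phase)
  have "(\<integral>q. cis (p \<bullet> phase q) * A q \<partial>lborel) = fourier H p" for p
  proof -
    have "fourier H p = (\<integral>q. cis (p \<bullet> q) * H q \<partial>distr ?D borel phase)"
      by (simp add: fourier_def distr_density_phase)
    also have "\<dots> = (\<integral>q. phase_jac q *\<^sub>R (cis (p \<bullet> phase q) * H (phase q)) \<partial>lborel)"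
      by (subst integral_distr[OF phD]) (auto simp: integral_density phase_jac_nonneg)
    also have "\<dots> = (\<integral>q. cis (p \<bullet> phase q) * A q \<partial>lborel)"
    proof (rule integral_cong_AE)
      show "AE q in lborel. phase_jac q *\<^sub>R (cis (p \<bullet> phase q) * H (phase q)) = cis (p \<bullet> phase q) * A q"
        using HA by eventually_elim (simp add: mult_scaleR_right[symmetric] del: mult_scaleR_right)
    qed measurable
    finally show ?thesis by simp
  qed
  moreover have "(\<integral>\<^sup>+q. ennreal ((norm (H q))\<^sup>2) \<partial>lborel) = (\<integral>\<^sup>+q. ennreal ((norm (A q))\<^sup>2) / ennreal (phase_jac q) \<partial>lborel)"
  proof -
    have "(\<integral>\<^sup>+q. ennreal ((norm (H q))\<^sup>2) \<partial>lborel) = (\<integral>\<^sup>+q. ennreal ((norm (H q))\<^sup>2) \<partial>distr ?D borel phase)"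
      by (simp add: distr_density_phase)
    also have "\<dots> = (\<integral>\<^sup>+q. ennreal (phase_jac q) * ennreal ((norm (H (phase q)))\<^sup>2) \<partial>lborel)"
      by (simp add: nn_integral_distr nn_integral_density)
    \<comment> \<open>Two Jacobian factors from the square of \<open>H\<close> against one from the
      measure leave a single one in the denominator.\<close>
    also have "\<dots> = (\<integral>\<^sup>+q. ennreal ((norm (A q))\<^sup>2) / ennreal (phase_jac q) \<partial>lborel)"
    proof (rule nn_integral_cong_AE, use HA in eventually_elim)
      case (elim q)
      then have j: "phase_jac q > 0" and Aq: "A q = phase_jac q *\<^sub>R H (phase q)" by auto
      show ?case
        using j by (simp add: Aq power_mult_distrib power2_eq_square divide_ennreal flip: ennreal_mult)
    qed
    finally show ?thesis .
  qed
  \<comment> \<open>The exponent is the dimension m * m + m of pairs of a matrix and a vector, with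
    m = \<open>CARD('m)\<close>.\<close>
  ultimately show ?thesis
    using plancherel[OF H] by (simp add: algebra_simps)
qed

section \<open>The product of extensions and the convolution identity\<close>

lemma prod_UNIV_option:
  fixes f :: "'m::finite option \<Rightarrow> 'a::comm_monoid_mult"
  shows "(\<Prod>j\<in>UNIV. f j) = (\<Prod>i\<in>UNIV. f (Some i)) * f None"
  by (simp add: UNIV_option_conv prod.reindex mult.commute)

text \<open>For \<open>d = 0\<close> both sides are 0 if \<open>a = 0\<close> and infinite
  otherwise. The power of 2 can thus be pulled out pointwise, also where the determinant
  vanishes.\<close>

lemma divide_ennreal_mult_left:
  assumes "c > 0" "d \<ge> 0"
  shows "a / ennreal (c * d) = ennreal (1 / c) * (a / ennreal d)"
proof (cases "d = 0")
  case True
  then show ?thesis using assms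
    by (simp add: divide_ennreal_def ennreal_mult_eq_top_iff) (simp add: ennreal_mult_top ennreal_top_mult)
next
  case False
  then show ?thesis using assms
    by (simp add: divide_ennreal_def inverse_ennreal ennreal_mult[symmetric] mult.left_commute)
      (simp add: field_simps)
qed

text \<open>With P(\<xi>) = (\<xi>, |\<xi>|^2), the total phase is the sum of x_i . (P(\<xi>_i) -
  P(\<xi>_n)) plus y . P(\<xi>_n), and the last term is absorbed into \<open>A\<close>.
  Integrability of \<open>A\<close> is that of the tensor product of the data, because the passage
  to differences preserves measure.\<close>

lemma extension_product:
  fixes g :: "'m::finite option \<Rightarrow> real ^ 'm \<Rightarrow> complex" and y :: "(real ^ 'm) \<times> real"
  defines "E h x \<equiv> (\<integral>\<zeta>. cis (fst x \<bullet> \<zeta> + snd x * (norm \<zeta>)\<^sup>2) * h \<zeta> \<partial>lborel)"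
    and "A q \<equiv> cis (fst y \<bullet> snd q + snd y * (norm (snd q))\<^sup>2) *
      ((\<Prod>i\<in>UNIV. g (Some i) (fst q $ i + snd q)) * g None (snd q))"
  assumes g: "\<And>j. integrable lborel (g j)"
  shows "integrable lborel A"
    and "(\<Prod>i\<in>UNIV. E (g (Some i)) (fst p $ i, snd p $ i)) * E (g None) (y - (\<Sum>i\<in>UNIV. (fst p $ i, snd p $ i))) =
      (\<integral>q. cis (p \<bullet> phase q) * A q \<partial>lborel)"
proof -
  interpret product_sigma_finite "\<lambda>_::'m option. lborel :: (real ^ 'm) measure" ..
  have gm[measurable]: "g j \<in> borel_measurable borel" for j using g[of j] by auto
  have [measurable]: "A \<in> borel_measurable borel"
    unfolding A_def by measurable
  define T :: "('m option \<Rightarrow> real ^ 'm) \<Rightarrow> _" where "T = (\<lambda>\<xi>. (\<chi> i. \<xi> (Some i) - \<xi> None, \<xi> None))"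
  note T = distr_PiM_lborel_differences[where 'm='m, folded T_def]
  have AT: "A (T \<xi>) = cis (fst y \<bullet> \<xi> None + snd y * (norm (\<xi> None))\<^sup>2) * (\<Prod>j\<in>UNIV. g j (\<xi> j))" for \<xi>
    by (simp add: A_def T_def prod_UNIV_option)
  have "integrable (\<Pi>\<^sub>M i\<in>UNIV. lborel) (\<lambda>\<xi>. A (T \<xi>))"
    unfolding AT by (intro integrable_cis_mult product_integrable_prod g) simp_all
  then have "integrable (distr (\<Pi>\<^sub>M i\<in>UNIV. lborel) borel T) A"
    by (subst integrable_distr_eq[OF T(1)]) auto
  then show "integrable lborel A" by (simp only: T(2))
  define x where "x j = (case j of None \<Rightarrow> y - (\<Sum>i\<in>UNIV. (fst p $ i, snd p $ i)) | Some i \<Rightarrow> (fst p $ i, snd p $ i))" for j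
  have phase_sum: "(\<Sum>i\<in>UNIV. fst (x (Some i)) \<bullet> \<xi> (Some i) + snd (x (Some i)) * (norm (\<xi> (Some i)))\<^sup>2) +
      (fst (x None) \<bullet> \<xi> None + snd (x None) * (norm (\<xi> None))\<^sup>2) =
      p \<bullet> phase (T \<xi>) + (fst y \<bullet> \<xi> None + snd y * (norm (\<xi> None))\<^sup>2)" for \<xi>
  proof -
    define \<eta> where "\<eta> = \<xi> None"
    define u where "u i = \<xi> (Some i) - \<eta>" for i
    have \<xi>: "\<xi> (Some i) = u i + \<eta>" for i by (simp add: u_def)
    have x_None: "fst (x None) = fst y - (\<Sum>i\<in>UNIV. fst p $ i)" "snd (x None) = snd y - (\<Sum>i\<in>UNIV. snd p $ i)"
      by (simp_all add: x_def fst_sum snd_sum)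
    have mv: "((2 *\<^sub>R (\<chi> i. u i)) *v \<eta>) $ i = 2 * (u i \<bullet> \<eta>)" for i
      by (simp add: matrix_vector_mult_def inner_vec_def sum_distrib_left mult_ac)
    have "p \<bullet> phase (T \<xi>) = (\<Sum>i\<in>UNIV. fst p $ i \<bullet> u i + snd p $ i * ((norm (u i))\<^sup>2 + 2 * (u i \<bullet> \<eta>)))"
      by (simp add: phase_def T_def \<eta>_def[symmetric] u_def[symmetric] inner_prod_def inner_vec_def[of "fst p"] 
        inner_vec_def[of "snd p"] mv sum.distrib)
    \<comment> \<open>In |u + \<eta>|^2 - |\<eta>|^2 the quadratic term in \<eta> cancels; this is
      the property of the paraboloid that makes the phase affine in \<eta>.\<close>
    also have "\<dots> = (\<Sum>i\<in>UNIV. (fst p $ i \<bullet> (u i + \<eta>) + snd p $ i * (norm (u i + \<eta>))\<^sup>2) - (fst p $ i \<bullet> \<eta> + snd p $ i * (norm \<eta>)\<^sup>2))"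
      by (intro sum.cong) (auto simp: power2_norm_eq_inner inner_add_left inner_add_right inner_commute algebra_simps)
    finally show ?thesis
      by (simp add: x_None \<xi> \<eta>_def[symmetric] x_def[of "Some _"] sum_subtractf sum.distrib inner_diff_left
        inner_sum_left sum_distrib_right left_diff_distrib)
  qed
  have "(\<Prod>i\<in>UNIV. E (g (Some i)) (fst p $ i, snd p $ i)) * E (g None) (y - (\<Sum>i\<in>UNIV. (fst p $ i, snd p $ i))) =
      (\<Prod>j\<in>UNIV. E (g j) (x j))"
    by (simp add: prod_UNIV_option x_def)
  also have "\<dots> = (\<integral>\<xi>. (\<Prod>j\<in>UNIV. cis (fst (x j) \<bullet> \<xi> j + snd (x j) * (norm (\<xi> j))\<^sup>2) * g j (\<xi> j)) \<partial>(\<Pi>\<^sub>M i\<in>UNIV. lborel))"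
    unfolding E_def by (intro product_integral_prod[symmetric] integrable_cis_mult g) simp_all
  also have "\<dots> = (\<integral>\<xi>. cis (p \<bullet> phase (T \<xi>)) * A (T \<xi>) \<partial>(\<Pi>\<^sub>M i\<in>UNIV. lborel))"
  proof (intro Bochner_Integration.integral_cong refl)
    fix \<xi> :: "'m option \<Rightarrow> real ^ 'm"
    have "(\<Prod>j\<in>UNIV. cis (fst (x j) \<bullet> \<xi> j + snd (x j) * (norm (\<xi> j))\<^sup>2)) =
        cis (p \<bullet> phase (T \<xi>)) * cis (fst y \<bullet> \<xi> None + snd y * (norm (\<xi> None))\<^sup>2)"
      unfolding cis_sum[symmetric] cis_mult phase_sum[symmetric]
      by (simp add: UNIV_option_conv sum.reindex add.commute)
    then show "(\<Prod>j\<in>UNIV. cis (fst (x j) \<bullet> \<xi> j + snd (x j) * (norm (\<xi> j))\<^sup>2) * g j (\<xi> j)) =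
        cis (p \<bullet> phase (T \<xi>)) * A (T \<xi>)"
      by (simp add: prod.distrib AT mult.assoc)
  qed
  also have "\<dots> = (\<integral>q. cis (p \<bullet> phase q) * A q \<partial>distr (\<Pi>\<^sub>M i\<in>UNIV. lborel) borel T)"
    by (rule integral_distr[symmetric, OF T(1)]) simp
  also have "\<dots> = (\<integral>q. cis (p \<bullet> phase q) * A q \<partial>lborel)" by (simp only: T(2))
  finally show "(\<Prod>i\<in>UNIV. E (g (Some i)) (fst p $ i, snd p $ i)) * E (g None) (y - (\<Sum>i\<in>UNIV. (fst p $ i, snd p $ i))) =
      (\<integral>q. cis (p \<bullet> phase q) * A q \<partial>lborel)" .
qed

lemma convolution_extension_lborel:
  fixes g :: "'m::finite option \<Rightarrow> real ^ 'm \<Rightarrow> complex" and y :: "(real ^ 'm) \<times> real"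
  defines "E h x \<equiv> (\<integral>\<zeta>. cis (fst x \<bullet> \<zeta> + snd x * (norm \<zeta>)\<^sup>2) * h \<zeta> \<partial>lborel)"
  assumes g: "\<And>j. integrable lborel (g j)"
  shows "(\<integral>\<^sup>+x. (\<Prod>i\<in>UNIV. ennreal ((cmod (E (g (Some i)) (x i)))\<^sup>2)) *
        ennreal ((cmod (E (g None) (y - (\<Sum>i\<in>UNIV. x i))))\<^sup>2) \<partial>(\<Pi>\<^sub>M i\<in>UNIV. lebesgue)) =
    ennreal ((2 * pi) ^ (CARD('m) * (CARD('m) + 1)) / 2 ^ CARD('m)) *
      (\<integral>\<^sup>+\<xi>. (\<Prod>j\<in>UNIV. ennreal ((cmod (g j (\<xi> j)))\<^sup>2)) / ennreal \<bar>det (affine_matrix \<xi>)\<bar>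
         \<partial>(\<Pi>\<^sub>M j\<in>UNIV. lebesgue))"
proof -
  have gm[measurable]: "g j \<in> borel_measurable borel" for j using g[of j] by auto
  have Em[measurable]: "E (g j) \<in> borel_measurable borel" for j
    unfolding E_def by measurable
  define A where "A q = cis (fst y \<bullet> snd q + snd y * (norm (snd q))\<^sup>2) *
      ((\<Prod>i\<in>UNIV. g (Some i) (fst q $ i + snd q)) * g None (snd q))" for q :: "(real ^ 'm ^ 'm) \<times> (real ^ 'm)"
  note ext = extension_product[where g = g and y = y, OF g, folded A_def E_def]
  have [measurable]: "A \<in> borel_measurable borel" using ext(1) by auto
  define T :: "('m \<Rightarrow> (real ^ 'm) \<times> real) \<Rightarrow> _" where "T = (\<lambda>x. (\<chi> i. fst (x i), \<chi> i. snd (x i)))"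
  note T = distr_PiM_lborel_pairs[where 'm='m, folded T_def]
  define S :: "('m option \<Rightarrow> real ^ 'm) \<Rightarrow> _" where "S = (\<lambda>\<xi>. (\<chi> i. \<xi> (Some i) - \<xi> None, \<xi> None))"
  note S = distr_PiM_lborel_differences[where 'm='m, folded S_def]
  define F where "F p = ennreal ((norm (\<integral>q. cis (p \<bullet> phase q) * A q \<partial>lborel))\<^sup>2)" for p
  have Fm: "F \<in> borel_measurable borel" unfolding F_def by measurable
  let ?k = "(2 * pi) ^ (CARD('m) * (CARD('m) + 1))"
  let ?I = "\<lambda>\<xi>. (\<Prod>j\<in>UNIV. ennreal ((cmod (g j (\<xi> j)))\<^sup>2)) / ennreal \<bar>det (affine_matrix \<xi>)\<bar>"
  have Im[measurable]: "?I \<in> borel_measurable (\<Pi>\<^sub>M j\<in>UNIV. lborel)"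
    unfolding det_affine_matrix by measurable
  have "(\<integral>\<^sup>+x. (\<Prod>i\<in>UNIV. ennreal ((cmod (E (g (Some i)) (x i)))\<^sup>2)) *
        ennreal ((cmod (E (g None) (y - (\<Sum>i\<in>UNIV. x i))))\<^sup>2) \<partial>(\<Pi>\<^sub>M i\<in>UNIV. lebesgue)) =
      (\<integral>\<^sup>+x. (\<Prod>i\<in>UNIV. ennreal ((cmod (E (g (Some i)) (x i)))\<^sup>2)) *
        ennreal ((cmod (E (g None) (y - (\<Sum>i\<in>UNIV. x i))))\<^sup>2) \<partial>(\<Pi>\<^sub>M i\<in>UNIV. lborel))"
    by (rule nn_integral_PiM_lebesgue) measurable
  also have "\<dots> = (\<integral>\<^sup>+x. F (T x) \<partial>(\<Pi>\<^sub>M i\<in>UNIV. lborel))"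
    unfolding F_def ext(2)[symmetric]
    by (intro nn_integral_cong)
      (simp add: T_def norm_mult prod_norm[symmetric] power_mult_distrib ennreal_mult prod_ennreal prod_nonneg prod_power_distrib)
  also have "\<dots> = (\<integral>\<^sup>+p. F p \<partial>lborel)"
    using nn_integral_distr[OF T(1), of F] Fm by (simp add: T(2))
  also have "\<dots> = ennreal ?k * (\<integral>\<^sup>+q. ennreal ((norm (A q))\<^sup>2) / ennreal (phase_jac q) \<partial>lborel)"
    unfolding F_def by (rule plancherel_phase[OF ext(1)])
  also have "(\<integral>\<^sup>+q. ennreal ((norm (A q))\<^sup>2) / ennreal (phase_jac q) \<partial>lborel) =
      (\<integral>\<^sup>+\<xi>. ennreal ((norm (A (S \<xi>)))\<^sup>2) / ennreal (phase_jac (S \<xi>)) \<partial>(\<Pi>\<^sub>M j\<in>UNIV. lborel))"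
    using nn_integral_distr[OF S(1), of "\<lambda>q. ennreal ((norm (A q))\<^sup>2) / ennreal (phase_jac q)"] by (simp add: S(2))
  also have "\<dots> = (\<integral>\<^sup>+\<xi>. ennreal (1 / 2 ^ CARD('m)) * ?I \<xi> \<partial>(\<Pi>\<^sub>M j\<in>UNIV. lborel))"
  proof (intro nn_integral_cong)
    fix \<xi> :: "'m option \<Rightarrow> real ^ 'm"
    have "(\<chi> i. \<xi> (Some i) - \<xi> None) = (\<chi> i j. (\<xi> (Some i) - \<xi> None) $ j)"
      by (simp add: vec_eq_iff)
    then have "phase_jac (S \<xi>) = 2 ^ CARD('m) * \<bar>det (affine_matrix \<xi>)\<bar>"
      by (simp add: phase_jac_eq S_def det_affine_matrix)
    \<comment> \<open>Here \<open>y\<close> disappears: it occurs only in the unimodular factor of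
      \<open>A\<close>.\<close>
    moreover have "ennreal ((norm (A (S \<xi>)))\<^sup>2) = (\<Prod>j\<in>UNIV. ennreal ((cmod (g j (\<xi> j)))\<^sup>2))"
      by (simp add: A_def S_def prod_UNIV_option norm_mult prod_norm[symmetric] power_mult_distrib ennreal_mult prod_ennreal prod_nonneg prod_power_distrib)
    ultimately show "ennreal ((norm (A (S \<xi>)))\<^sup>2) / ennreal (phase_jac (S \<xi>)) = ennreal (1 / 2 ^ CARD('m)) * ?I \<xi>"
      by (simp only: divide_ennreal_mult_left zero_less_power zero_less_numeral abs_ge_zero)
  qed
  also have "\<dots> = ennreal (1 / 2 ^ CARD('m)) * (\<integral>\<^sup>+\<xi>. ?I \<xi> \<partial>(\<Pi>\<^sub>M j\<in>UNIV. lborel))"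
    by (rule nn_integral_cmult) measurable
  also have "(\<integral>\<^sup>+\<xi>. ?I \<xi> \<partial>(\<Pi>\<^sub>M j\<in>UNIV. lborel)) = (\<integral>\<^sup>+\<xi>. ?I \<xi> \<partial>(\<Pi>\<^sub>M j\<in>UNIV. lebesgue))"
    by (rule nn_integral_PiM_lebesgue[symmetric]) measurable
  finally show ?thesis
    by (simp add: mult.assoc[symmetric] ennreal_mult[symmetric])
qed

theorem theorem1p2:
  fixes g :: "'m::finite option \<Rightarrow> real ^ 'm \<Rightarrow> complex" and n :: nat
  assumes "n \<ge> 2" and "CARD('m) = n - 1"
    and "\<And>j. integrable lebesgue (g j)"
  shows "nfold_convolution (\<lambda>j x. ennreal ((cmod (paraboloid_extension (g j) x))\<^sup>2)) =
    (\<lambda>y. ennreal ((2 * pi) ^ (n * (n - 1)) / 2 ^ (n - 1)) *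
      (\<integral>\<^sup>+ \<xi>. (\<Prod>j\<in>UNIV. ennreal ((cmod (g j (\<xi> j)))\<^sup>2)) / ennreal \<bar>det (affine_matrix \<xi>)\<bar>
         \<partial>(\<Pi>\<^sub>M j\<in>UNIV. lebesgue)))"
proof
  fix y :: "(real ^ 'm) \<times> real"
  have "\<forall>j. \<exists>g'. integrable lborel g' \<and> (AE x in lebesgue. g j x = g' x)"
    using integrable_lebesgue_borel_version[OF assms(3)] by metis
  then obtain h where h: "\<And>j. integrable lborel (h j)" "\<And>j. AE x in lebesgue. g j x = h j x"
    by metis
  \<comment> \<open>This holds at every point, so on the side of the convolution the representatives
    can be substituted without an exceptional set.\<close>
  have ext: "paraboloid_extension (g j) = (\<lambda>x. \<integral>\<xi>. cis (fst x \<bullet> \<xi> + snd x * (norm \<xi>)\<^sup>2) * h j \<xi> \<partial>lborel)" for j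
    using paraboloid_extension_lborel[OF h] assms(3)[of j] by auto
  have n: "CARD('m) * (CARD('m) + 1) = n * (n - 1)" using assms(1,2) by simp
  \<comment> \<open>On the other side the data occur pointwise, and finitely many null cylinders
    have to be discarded.\<close>
  have "AE \<xi> in (\<Pi>\<^sub>M j\<in>(UNIV :: 'm option set). lebesgue). \<forall>j\<in>UNIV. g j (\<xi> j) = h j (\<xi> j)"
    using h(2) by (intro AE_finite_allI AE_PiM_lebesgue_component) auto
  then have "(\<integral>\<^sup>+ \<xi>. (\<Prod>j\<in>UNIV. ennreal ((cmod (g j (\<xi> j)))\<^sup>2)) / ennreal \<bar>det (affine_matrix \<xi>)\<bar> \<partial>(\<Pi>\<^sub>M j\<in>UNIV. lebesgue)) =
      (\<integral>\<^sup>+ \<xi>. (\<Prod>j\<in>UNIV. ennreal ((cmod (h j (\<xi> j)))\<^sup>2)) / ennreal \<bar>det (affine_matrix \<xi>)\<bar> \<partial>(\<Pi>\<^sub>M j\<in>UNIV. lebesgue))"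
    by (intro nn_integral_cong_AE) (auto elim!: eventually_mono)
  then show "nfold_convolution (\<lambda>j x. ennreal ((cmod (paraboloid_extension (g j) x))\<^sup>2)) y =
    ennreal ((2 * pi) ^ (n * (n - 1)) / 2 ^ (n - 1)) *
      (\<integral>\<^sup>+ \<xi>. (\<Prod>j\<in>UNIV. ennreal ((cmod (g j (\<xi> j)))\<^sup>2)) / ennreal \<bar>det (affine_matrix \<xi>)\<bar>
         \<partial>(\<Pi>\<^sub>M j\<in>UNIV. lebesgue))"
    using convolution_extension_lborel[where g = h and y = y, OF h(1)] assms(2)
    unfolding nfold_convolution_def ext n by simp
qed

end
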